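(* Let $k$ be an even integer, let $Z\in\mathbb{H}_2$, and let $s\in\mathbb{C}$ with $2\,\mathrm{Re}(s)+k>3$. Then $$E_k^{(2)}(Z,s)=A_k(Z,s)+\sum_{m=1}^{\infty}\left(B_k\Big|_k\left(\Gamma\begin{pmatrix} m & 0 \\ 0 & m^{-1} \end{pmatrix}\Gamma\right)^{\bullet}\right)(Z,s)\;m^{-2s-k}.$$
   Context: $\mathbb{H}_2$ is the Siegel upper half-space of degree $2$, with elements $Z=\begin{pmatrix} \tau & z \\ z & \tilde\tau \end{pmatrix}$. $\mathrm{Sp}_2(\mathbb{R})$ (symplectic $4\times4$ matrices $g=\begin{pmatrix} A & B \\ C & D \end{pmatrix}$ in $2\times2$ blocks) acts by $g(Z)=(AZ+B)(CZ+D)^{-1}$; $j(g,Z)=\det(CZ+D)$; $\delta(Z)=\det(\mathrm{Im}\,Z)$. $\Gamma_2=\mathrm{Sp}_2(\mathbb{Z})$, $\Gamma_{2,0}\subset\Gamma_2$ is the subgroup with $C=0$, and for $2\,\mathrm{Re}(s)+k>3$ $$E_k^{(2)}(Z,s)=\sum_{g\in\Gamma_{2,0}\backslash\Gamma_2}j(g,Z)^{-k}\,\delta(g(Z))^{s}.$$ $\Gamma=\mathrm{SL}_2(\mathbb{Z})$ and $\Gamma_\infty\subset\Gamma$ is the subgroup of matrices with lower left entry $0$. For $A=\begin{pmatrix} a & b \\ c & d \end{pmatrix}$, $B=\begin{pmatrix} e & f \\ g & h \end{pmatrix}$ in $\mathrm{SL}_2(\mathbb{R})$ put $$A\times B=\begin{pmatrix}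 a & 0 & b & 0 \\ 0 & e & 0 & f \\ c & 0 & d & 0 \\ 0 & g & 0 & h \end{pmatrix}\in\mathrm{Sp}_2(\mathbb{R}),\qquad A^\bullet=A\times 1_2,\quad A_\bullet=1_2\times A.$$ Put $\varphi(Z)=\tau+2z+\tilde\tau$, $\Phi_{k,s}(Z)=\varphi(Z)^{-k}|\varphi(Z)|^{-2s}$, $\chi_{k,s}(g,Z)=j(g,Z)^{-k}|j(g,Z)|^{-2s}$, and define on $\mathbb{H}_2\times\{s\in\mathbb{C}: 2\,\mathrm{Re}(s)+k>3\}$ $$A_k(Z,s)=\delta(Z)^s\sum_{g,h\in\Gamma_\infty\backslash\Gamma}\chi_{k,s}(g^\bullet h_\bullet,Z),\qquad B_k(Z,s)=\delta(Z)^s\sum_{g\in\Gamma}\Phi_{k,s}(g_\bullet(Z))\,\chi_{k,s}(g_\bullet,Z).$$ Slash operator: $(F|_kg)(Z)=j(g,Z)^{-k}F(g(Z))$, with $s$ a fixed parameter. For $g_0\in\mathrm{SL}_2(\mathbb{Q})$ and $F$ with $F|_k\gamma^\bullet=F$ for all $\gamma\in\Gamma$, $F|_k(\Gamma g_0\Gamma)^\bullet=\sum_{\gamma\in\Gamma\backslash\Gamma g_0\Gamma}F|_k\gamma^\bullet$. *)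

theory Defs
  imports "HOL-Analysis.Analysis"
begin

definition map_mat :: "('a \<Rightarrow> 'b) \<Rightarrow> 'a^'n^'m \<Rightarrow> 'b^'n^'m" where
  "map_mat f M = (\<chi> i j. f (M $ i $ j))"

definition mat2 :: "'a \<Rightarrow> 'a \<Rightarrow> 'a \<Rightarrow> 'a \<Rightarrow> ('a::zero)^2^2" where
  "mat2 a b c d = vector [vector [a, b], vector [c, d]]"

definition siegel_H2 :: "(complex^2^2) set" where
  "siegel_H2 = {Z. transpose Z = Z \<and> (\<forall>v::real^2. v \<noteq> 0 \<longrightarrow> v \<bullet> (map_mat Im Z *v v) > 0)}"

definition sympl_J :: "real^4^4" where
  "sympl_J = vector [vector [0, 0, 1, 0],
                     vector [0, 0, 0, 1],
                     vector [-1, 0, 0, 0],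
                     vector [0, -1, 0, 0]]"

definition Sp2_real :: "(real^4^4) set" where
  "Sp2_real = {g. transpose g ** sympl_J ** g = sympl_J}"

definition blockA :: "real^4^4 \<Rightarrow> real^2^2" where
  "blockA g = mat2 (g$1$1) (g$1$2) (g$2$1) (g$2$2)"

definition blockB :: "real^4^4 \<Rightarrow> real^2^2" where
  "blockB g = mat2 (g$1$3) (g$1$4) (g$2$3) (g$2$4)"

definition blockC :: "real^4^4 \<Rightarrow> real^2^2" where
  "blockC g = mat2 (g$3$1) (g$3$2) (g$4$1) (g$4$2)"

definition blockD :: "real^4^4 \<Rightarrow> real^2^2" where
  "blockD g = mat2 (g$3$3) (g$3$4) (g$4$3) (g$4$4)"

abbreviation cmat :: "real^'n^'m \<Rightarrow> complex^'n^'m" where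
  "cmat \<equiv> map_mat complex_of_real"

definition act :: "real^4^4 \<Rightarrow> complex^2^2 \<Rightarrow> complex^2^2" where
  "act g Z = (cmat (blockA g) ** Z + cmat (blockB g)) **
             matrix_inv (cmat (blockC g) ** Z + cmat (blockD g))"

definition jfac :: "real^4^4 \<Rightarrow> complex^2^2 \<Rightarrow> complex" where
  "jfac g Z = det (cmat (blockC g) ** Z + cmat (blockD g))"

definition delta :: "complex^2^2 \<Rightarrow> real" where
  "delta Z = det (map_mat Im Z)"

definition Gamma2 :: "(real^4^4) set" where
  "Gamma2 = {g \<in> Sp2_real. \<forall>i j. g $ i $ j \<in> \<int>}"

definition Gamma20 :: "(real^4^4) set" where
  "Gamma20 = {g \<in> Gamma2. blockC g = 0}"

definition SL2Z :: "(real^2^2) set" where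
  "SL2Z = {g. det g = 1 \<and> (\<forall>i j. g $ i $ j \<in> \<int>)}"

definition SL2Z_inf :: "(real^2^2) set" where
  "SL2Z_inf = {g \<in> SL2Z. g $ 2 $ 1 = 0}"

text \<open>The quotient \<open>H \ S\<close> is the set of cosets \<open>H g\<close> with \<open>g\<close> in \<open>S\<close>. Sums over it evaluate the
  summand at a chosen representative; for \<open>k\<close> even the summands below are constant on
  cosets (in \<open>hecke\<close>, if \<open>F\<close> is invariant under the slash action of all embedded elements of
  \<open>SL2Z\<close>).\<close>

definition left_quot :: "(real^'n^'n) set \<Rightarrow> (real^'n^'n) set \<Rightarrow> (real^'n^'n) set set" where
  "left_quot H S = (\<lambda>g. (\<lambda>h. h ** g) ` H) ` S"

definition coset_rep :: "'a set \<Rightarrow> 'a" where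
  "coset_rep c = (SOME g. g \<in> c)"

definition cross_mat :: "real^2^2 \<Rightarrow> real^2^2 \<Rightarrow> real^4^4" where
  "cross_mat A B = vector [vector [A$1$1, 0, A$1$2, 0],
                           vector [0, B$1$1, 0, B$1$2],
                           vector [A$2$1, 0, A$2$2, 0],
                           vector [0, B$2$1, 0, B$2$2]]"

definition upper_emb :: "real^2^2 \<Rightarrow> real^4^4" where
  "upper_emb A = cross_mat A (mat 1)"

definition lower_emb :: "real^2^2 \<Rightarrow> real^4^4" where
  "lower_emb A = cross_mat (mat 1) A"

definition Eis2 :: "int \<Rightarrow> complex \<Rightarrow> complex^2^2 \<Rightarrow> complex" where
  "Eis2 k s Z = (\<Sum>\<^sub>\<infinity>c \<in> left_quot Gamma20 Gamma2.
     let g = coset_rep c in jfac g Z powi (-k) * complex_of_real (delta (act g Z)) powr s)"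

definition phi :: "complex^2^2 \<Rightarrow> complex" where
  "phi Z = Z$1$1 + 2 * Z$1$2 + Z$2$2"

definition Phi :: "int \<Rightarrow> complex \<Rightarrow> complex^2^2 \<Rightarrow> complex" where
  "Phi k s Z = phi Z powi (-k) * complex_of_real (cmod (phi Z)) powr (-2 * s)"

definition chi :: "int \<Rightarrow> complex \<Rightarrow> real^4^4 \<Rightarrow> complex^2^2 \<Rightarrow> complex" where
  "chi k s g Z = jfac g Z powi (-k) * complex_of_real (cmod (jfac g Z)) powr (-2 * s)"

definition A_fun :: "int \<Rightarrow> complex \<Rightarrow> complex^2^2 \<Rightarrow> complex" where
  "A_fun k s Z = complex_of_real (delta Z) powr s *
     (\<Sum>\<^sub>\<infinity>(c, d) \<in> left_quot SL2Z_inf SL2Z \<times> left_quot SL2Z_inf SL2Z.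
        chi k s (upper_emb (coset_rep c) ** lower_emb (coset_rep d)) Z)"

definition B_fun :: "int \<Rightarrow> complex \<Rightarrow> complex^2^2 \<Rightarrow> complex" where
  "B_fun k s Z = complex_of_real (delta Z) powr s *
     (\<Sum>\<^sub>\<infinity>g \<in> SL2Z. Phi k s (act (lower_emb g) Z) * chi k s (lower_emb g) Z)"

definition slash :: "int \<Rightarrow> (complex^2^2 \<Rightarrow> complex) \<Rightarrow> real^4^4 \<Rightarrow> complex^2^2 \<Rightarrow> complex" where
  "slash k F g Z = jfac g Z powi (-k) * F (act g Z)"

definition double_coset :: "real^2^2 \<Rightarrow> (real^2^2) set" where
  "double_coset g0 = {a ** g0 ** b | a b. a \<in> SL2Z \<and> b \<in> SL2Z}"

text \<open>For rational \<open>g0\<close> the index set below is finite, so this is an ordinary sum.\<close>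

definition hecke :: "int \<Rightarrow> (complex^2^2 \<Rightarrow> complex) \<Rightarrow> real^2^2 \<Rightarrow> complex^2^2 \<Rightarrow> complex" where
  "hecke k F g0 Z = (\<Sum>\<^sub>\<infinity>c \<in> left_quot SL2Z (double_coset g0).
     slash k F (upper_emb (coset_rep c)) Z)"

end

theory Submission
  imports Defs "HOL-Computational_Algebra.Primes"
begin

text \<open>
  A coset in \<open>Gamma20 \ Gamma2\<close> is a Lagrangian plane, recorded up to sign by the primitive integral
  Pluecker vector \<open>(N, t)\<close> of the bottom rows, with \<open>N\<close> a \<open>2 \<times> 2\<close> matrix and \<open>det N = - t\<^sup>2\<close>. Its term in
  the Eisenstein series depends only on the value at \<open>(N, t)\<close> of a linear form attached to \<open>Z\<close>.
  Split the symplectic space into the two planes on which the factors of \<open>SL2 \<times> SL2\<close> act. If \<open>t = 0\<close>,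
  the Lagrangian is a sum of two lines, \<open>N\<close> is a tensor product of primitive vectors, and these
  cosets give \<open>A_k\<close>. If \<open>t = m > 0\<close>, the Lagrangian is the graph of an anti-isometry between the
  two planes, \<open>N = m \<gamma>\<^sup>T w g\<close> with \<open>\<gamma>\<close> in the double coset of \<open>diag (m, 1/m)\<close> and \<open>g\<close> in
  \<open>SL2Z\<close>, and these cosets give the Hecke translates of \<open>B_k\<close>. Smith normal form shows that every
  primitive vector arises.

  Absolute convergence follows from two facts: by compactness, the linear form is bounded below by a multiple of
  the norm on the isotropic cone, and the sum of \<open>norm powr (-\<sigma>)\<close> over nonzero integral isotropic vectors
  converges for \<open>\<sigma> > 3\<close>.
\<close>

section \<open>Summation over integral isotropic vectors\<close>

text \<open>The threshold 3 is the growth exponent of the cone: a quadric in five variables such as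
  \<open>det N = - t^2\<close> has on the order of H^3 integral points of norm at most H. The
  function \<phi> of the statement is itself an automorphy factor: \<open>phi Z\<close> is
  \<open>autom Z (swap2, 1)\<close>, the value at the Lagrangian of \<open>base_point 1\<close>. The
  Lagrangians with t nonzero are translates of this one by pairs in SL2(Q) and SL2(Z). Scaling the
  translated vector by m, which makes it primitive, produces the factor
  \<open>m powr (-2 * s - k)\<close>. Pluecker vectors are known only up to sign, because elements
  of \<open>Gamma20\<close> may have det D = -1. Evenness of k makes the terms blind to this sign,
  and in the graph case the sign is spent on making t positive. The obstacle is that
  \<open>infsum\<close> returns 0 on a family that is not summable, so every splitting and
  regrouping must be justified. One family, indexed by the cosets of \<open>Gamma20\<close>, is
  shown to be summable; the other sums arise from it by restriction, bijection and iteration, and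
  scalars pass through \<open>infsum\<close> unconditionally.\<close>

definition wt :: "real \<Rightarrow> int \<Rightarrow> real" where
  "wt \<rho> x = (max 1 \<bar>real_of_int x\<bar>) powr (-\<rho>)"

lemma wt_nonneg [simp]: "wt \<rho> x \<ge> 0"
  by (simp add: wt_def)

lemma wt_summable:
  assumes "\<rho> > 1"
  shows "wt \<rho> summable_on UNIV"
proof -
  let ?f = "\<lambda>n::nat. (max 1 (real n)) powr (-\<rho>)"
  have "summable (\<lambda>n::nat. real n powr (-\<rho>))"
    using assms by (subst summable_real_powr_iff) auto
  moreover have "\<exists>N. \<forall>n\<ge>N. norm (?f n) \<le> real n powr (-\<rho>)"
    by (rule exI[of _ 1]) auto
  ultimately have "summable ?f"
    by (rule summable_comparison_test[rotated])
  hence f: "?f summable_on UNIV"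
    by (intro summable_nonneg_imp_summable_on) auto
  have 1: "wt \<rho> summable_on (range int)"
    by (subst summable_on_reindex) (use f in \<open>auto simp: wt_def o_def inj_on_def\<close>)
  have 2: "wt \<rho> summable_on (range (\<lambda>n. - int n))"
    by (subst summable_on_reindex) (use f in \<open>auto simp: wt_def o_def inj_on_def\<close>)
  have "UNIV = range int \<union> range (\<lambda>n. - int n)"
    by (auto simp: image_iff) (metis int_cases2)
  with 1 2 show ?thesis
    by (metis summable_on_union)
qed

lemma summable_on_Times_nonneg:
  fixes f :: "'a \<Rightarrow> real" and g :: "'b \<Rightarrow> real"
  assumes "f summable_on UNIV" "g summable_on UNIV" "\<And>x. f x \<ge> 0" "\<And>y. g y \<ge> 0"
  shows "(\<lambda>z. f (fst z) * g (snd z)) summable_on UNIV"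
proof -
  have "(\<lambda>z. norm (f (fst z) * g (snd z))) summable_on (Sigma UNIV (\<lambda>_. UNIV))"
    by (subst Infinite_Sum.abs_summable_on_Sigma_iff)
       (use assms in \<open>auto simp: abs_mult infsum_cmult_right' intro!: summable_on_cmult_right summable_on_cmult_left\<close>)
  hence "(\<lambda>z. f (fst z) * g (snd z)) summable_on (UNIV \<times> UNIV)"
    by (rule abs_summable_summable)
  thus ?thesis by simp
qed

text \<open>The nesting pairs the entries of each column, so exchanging the rows is mere
  commutativity of the two inner maxima.\<close>

definition maxabs :: "int \<times> int \<times> int \<times> int \<times> int \<Rightarrow> real" where
  "maxabs = (\<lambda>(a,b,c,d,t). max (max \<bar>a\<bar> \<bar>c\<bar>) (max (max \<bar>b\<bar> \<bar>d\<bar>) \<bar>t\<bar>))"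

lemma maxabs_ge:
  "\<bar>real_of_int a\<bar> \<le> maxabs (a,b,c,d,t)" "\<bar>real_of_int b\<bar> \<le> maxabs (a,b,c,d,t)"
  "\<bar>real_of_int c\<bar> \<le> maxabs (a,b,c,d,t)" "\<bar>real_of_int d\<bar> \<le> maxabs (a,b,c,d,t)"
  "\<bar>real_of_int t\<bar> \<le> maxabs (a,b,c,d,t)"
  by (simp_all add: maxabs_def le_max_iff_disj)

lemma maxabs_swap: "maxabs (c,d,a,b,t) = maxabs (a,b,c,d,t)"
  unfolding maxabs_def prod.case max.commute[of "\<bar>real_of_int c\<bar>" "\<bar>real_of_int a\<bar>"]
    max.commute[of "\<bar>real_of_int d\<bar>" "\<bar>real_of_int b\<bar>"] ..

lemma summable_on_by_injection:
  fixes f :: "'a \<Rightarrow> real" and g :: "'b \<Rightarrow> real"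
  assumes "g summable_on UNIV" "inj_on h A" "\<And>x. x \<in> A \<Longrightarrow> 0 \<le> f x \<and> f x \<le> K * g (h x)"
  shows "f summable_on A"
proof -
  have "g summable_on h ` A"
    using assms(1) by (rule summable_on_subset_banach) auto
  hence "(g \<circ> h) summable_on A"
    using assms(2) by (simp add: summable_on_reindex)
  hence "(\<lambda>x. K * (g \<circ> h) x) summable_on A"
    by (rule summable_on_cmult_right)
  thus ?thesis
    by (rule summable_on_comparison_test) (use assms(3) in auto)
qed

text \<open>Turns a cubic bound on a product into a bound on terms of the series. The callers take
  \<rho> = \<sigma> / 3, so that \<sigma> > 3 becomes the condition \<rho> > 1 for each
  one-dimensional sum.\<close>

lemma maxabs_powr_le:
  assumes "P > 0" "P \<le> 4 * maxabs p ^ 3" "\<rho> > 0" "\<sigma> = 3 * \<rho>" "maxabs p > 0"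
  shows "maxabs p powr (-\<sigma>) \<le> 4 powr \<rho> * P powr (-\<rho>)"
proof -
  have "maxabs p powr (-\<sigma>) = (maxabs p ^ 3) powr (-\<rho>)"
    using assms by (simp add: powr_powr flip: powr_numeral)
  also have "\<dots> \<le> (P / 4) powr (-\<rho>)"
    using assms by (intro powr_mono2') auto
  also have "\<dots> = 4 powr \<rho> * P powr (-\<rho>)"
    using assms by (simp add: powr_divide powr_minus field_simps)
  finally show ?thesis .
qed

text \<open>Five factors cost only three powers of H because four of them pair up. In the
  application \<open>a * g\<close> is the size of an entry of the first column, and
  \<open>c * q\<close> is controlled by \<open>b\<close> through |c'| <= |a'| and division with
  remainder of b by a'.\<close>

lemma five_factor_bound:
  fixes a c g q t H :: real
  assumes "t \<le> H" "1 \<le> H" "a * g \<le> H" "c * q \<le> 2 * H"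
    and nonneg: "0 \<le> t" "0 \<le> a" "0 \<le> c" "0 \<le> g" "0 \<le> q"
  shows "t * (a * (c * (g * q))) \<le> 4 * H ^ 3"
proof -
  have "(a * g) * (c * q) \<le> H * (2 * H)"
    by (rule mult_mono) (use assms in simp_all)
  hence "t * ((a * g) * (c * q)) \<le> H * (H * (2 * H))"
    by (rule mult_mono[OF assms(1)]) (use assms in simp_all)
  also have "\<dots> = 2 * H ^ 3" by (simp add: power3_eq_cube)
  also have "\<dots> \<le> 4 * H ^ 3" using assms by simp
  finally show ?thesis by (simp only: mult_ac)
qed

text \<open>Write the first column as \<open>g (a', c')\<close> with \<open>g = gcd a c\<close>. The second column is then
  determined modulo \<open>(a', c')\<close>, so it is recovered from \<open>t\<close> and \<open>q = b div a'\<close>. Since the five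
  integers \<open>t, a', c', g, q\<close> satisfy \<open>\<Prod> max 1 \<bar>x\<bar> \<le> 4 H\<^sup>3\<close> for the maximum norm \<open>H\<close>, the sum
  is dominated by a product of five convergent one-dimensional sums.\<close>

lemma summable_wide_column:
  fixes F :: "int \<Rightarrow> int"
  assumes "\<sigma> > 3"
  shows "(\<lambda>p. maxabs p powr (-\<sigma>)) summable_on
           {(a,b,c,d,t). a * d - b * c = F t \<and> \<bar>c\<bar> \<le> \<bar>a\<bar> \<and> a \<noteq> 0}" (is "_ summable_on ?S")
proof -
  define \<rho> where "\<rho> = \<sigma> / 3"
  have \<rho>: "\<rho> > 1" "\<sigma> = 3 * \<rho>" using assms by (auto simp: \<rho>_def)
  define h where "h = (\<lambda>(a,b,c,d::int,t::int). (t, a div gcd a c, c div gcd a c, gcd a c, b div (a div gcd a (c::int)) :: int))"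
  define w2 where "w2 = (\<lambda>p. wt \<rho> (fst p) * wt \<rho> (snd p))"
  define w3 where "w3 = (\<lambda>p. wt \<rho> (fst p) * w2 (snd p))"
  define w4 where "w4 = (\<lambda>p. wt \<rho> (fst p) * w3 (snd p))"
  define w where "w = (\<lambda>p. wt \<rho> (fst p) * w4 (snd p))"
  have nonneg: "\<And>p. w2 p \<ge> 0" "\<And>p. w3 p \<ge> 0" "\<And>p. w4 p \<ge> 0"
    by (simp_all add: w2_def w3_def w4_def)
  have "w2 summable_on UNIV"
    unfolding w2_def by (intro summable_on_Times_nonneg wt_summable \<rho>) auto
  hence "w3 summable_on UNIV"
    unfolding w3_def by (intro summable_on_Times_nonneg wt_summable \<rho>) (auto intro: nonneg)
  hence "w4 summable_on UNIV"
    unfolding w4_def by (intro summable_on_Times_nonneg wt_summable \<rho>) (auto intro: nonneg)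
  hence "w summable_on UNIV"
    unfolding w_def by (intro summable_on_Times_nonneg wt_summable \<rho>) (auto intro: nonneg)
  moreover have "inj_on h ?S"
  proof (rule inj_onI)
    fix p p2 assume "p \<in> ?S" "p2 \<in> ?S" and hp: "h p = h p2"
    then obtain a b c d t a2 b2 c2 d2 t2
      where p: "p = (a,b,c,d,t)" "p2 = (a2,b2,c2,d2,t2)"
        and e: "a * d - b * c = F t" "a2 * d2 - b2 * c2 = F t2" "a \<noteq> 0"
      by blast
    from hp have h: "t = t2" "a div gcd a c = a2 div gcd a2 c2" "c div gcd a c = c2 div gcd a2 c2"
      "gcd a c = gcd a2 c2" "b div (a div gcd a c) = b2 div (a2 div gcd a2 c2)"
      by (auto simp: h_def p)
    have "a = a div gcd a c * gcd a c" "a2 = a2 div gcd a2 c2 * gcd a2 c2"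
       "c = c div gcd a c * gcd a c" "c2 = c2 div gcd a2 c2 * gcd a2 c2"
      by simp_all
    with h have ac: "a2 = a" "c2 = c" by metis+
    define g where "g = gcd a c"
    define a' where "a' = a div g"
    define c' where "c' = c div g"
    have a': "a = a' * g" "c = c' * g" by (auto simp: a'_def c'_def g_def)
    have g0: "g \<noteq> 0" using e by (auto simp: g_def)
    have cop: "coprime a' c'" unfolding a'_def c'_def g_def
      by (rule div_gcd_coprime) (use e in auto)
    have "a * d - b * c = a * d2 - b2 * c"
      using e(1,2) h(1) unfolding ac by simp
    hence "a * (d - d2) = c * (b - b2)"
      by (simp add: algebra_simps)
    hence "g * (a' * (d - d2)) = g * (c' * (b - b2))" by (simp add: a' algebra_simps)
    hence "a' * (d - d2) = c' * (b - b2)" using g0 by simp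
    hence "a' dvd c' * (b - b2)" by (metis dvd_triv_left)
    hence "a' dvd b - b2" using cop by (simp add: coprime_dvd_mult_right_iff)
    hence "b mod a' = b2 mod a'" by (simp add: mod_eq_dvd_iff)
    moreover have "b div a' = b2 div a'" using h(5) unfolding ac a'_def g_def .
    ultimately have b: "b = b2" by (metis mult_div_mod_eq)
    hence "a * (d - d2) = 0" using \<open>a * (d - d2) = c * (b - b2)\<close> by simp
    hence "d = d2" using e by simp
    with b ac h(1) show "p = p2" by (simp only: p)
  qed
  moreover have "0 \<le> maxabs p powr (-\<sigma>) \<and> maxabs p powr (-\<sigma>) \<le> 4 powr \<rho> * w (h p)" if "p \<in> ?S" for p
  proof -
    obtain a b c d t where p: "p = (a,b,c,d,t)" by (cases p) auto
    with that have s: "\<bar>c\<bar> \<le> \<bar>a\<bar>" "a \<noteq> 0" by auto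
    define g where "g = gcd a c"
    define a' where "a' = a div g"
    define c' where "c' = c div g"
    define q where "q = b div a'"
    have a': "a = a' * g" "c = c' * g" by (auto simp: a'_def c'_def g_def)
    have "gcd a c > 0" using s(2) by simp
    hence g0: "g \<ge> 1" unfolding g_def by linarith
    have a'0: "\<bar>a'\<bar> \<ge> 1" using s a' by auto
    have c'a': "\<bar>c'\<bar> \<le> \<bar>a'\<bar>" using s g0 unfolding a' by (simp add: abs_mult)
    \<comment> \<open>The integers t, c' and q may vanish; \<open>max 1\<close> keeps every factor
      positive, whereas \<open>0 powr\<close> would contribute the value 0.\<close>
    let ?n = "\<lambda>x::int. max 1 \<bar>real_of_int x\<bar>"
    define H where "H = maxabs p"
    have H: "\<bar>real_of_int a\<bar> \<le> H" "\<bar>real_of_int b\<bar> \<le> H" "\<bar>real_of_int t\<bar> \<le> H"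
      unfolding H_def p by (rule maxabs_ge)+
    have H1: "H \<ge> 1" using H(1) s by linarith
    have nt: "?n t \<le> H" using H(3) H1 by simp
    have A: "\<bar>real_of_int a'\<bar> * g \<le> H" using H(1) g0 by (simp add: a' abs_mult)
    have B: "\<bar>a'\<bar> * \<bar>q\<bar> \<le> \<bar>b\<bar> + \<bar>a'\<bar> * g"
    proof -
      have "b = a' * q + b mod a'" by (simp add: q_def)
      moreover have "\<bar>b mod a'\<bar> < \<bar>a'\<bar>" using a'0 by (intro abs_mod_less) auto
      moreover have "\<bar>a'\<bar> \<le> \<bar>a'\<bar> * g" using g0 a'0 by (simp add: mult_le_cancel_left1)
      ultimately show ?thesis by (simp flip: abs_mult)
    qed
    have "real_of_int (\<bar>a'\<bar> * \<bar>q\<bar>) \<le> real_of_int (\<bar>b\<bar> + \<bar>a'\<bar> * g)" using B by (simp only: of_int_le_iff)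
    hence "\<bar>real_of_int a'\<bar> * \<bar>real_of_int q\<bar> \<le> 2 * H" using A H by simp
    moreover have "\<bar>real_of_int a'\<bar> \<le> 2 * H"
    proof -
      have "\<bar>real_of_int a'\<bar> * 1 \<le> \<bar>real_of_int a'\<bar> * g" using g0 by (intro mult_left_mono) auto
      thus ?thesis using A H1 by linarith
    qed
    ultimately have C: "\<bar>real_of_int a'\<bar> * ?n q \<le> 2 * H"
      by (auto simp: max_def)
    have r1: "1 \<le> \<bar>real_of_int a'\<bar>" "1 \<le> real_of_int g" using a'0 g0 by linarith+
    have "?n a' * ?n g \<le> H" using A r1 by simp
    moreover have "?n c' * ?n q \<le> 2 * H"
    proof -
      have "\<bar>real_of_int c'\<bar> \<le> \<bar>real_of_int a'\<bar>" using c'a' by linarith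
      hence "?n c' * ?n q \<le> \<bar>real_of_int a'\<bar> * ?n q" using r1 by (intro mult_right_mono) auto
      with C show ?thesis by simp
    qed
    moreover have n0: "?n x > 0" for x by simp
    ultimately have P: "?n t * (?n a' * (?n c' * (?n g * ?n q))) \<le> 4 * H ^ 3" (is "?P \<le> _")
      by (intro five_factor_bound nt H1) (simp_all only: less_imp_le)
    have "?P > 0" by (intro mult_pos_pos n0)
    moreover have "\<rho> > 0" "maxabs p > 0" using \<rho>(1) H1 by (simp_all add: H_def)
    ultimately have "maxabs p powr (-\<sigma>) \<le> 4 powr \<rho> * ?P powr (-\<rho>)"
      by (intro maxabs_powr_le P[unfolded H_def] \<rho>(2))
    also have "?P powr (-\<rho>) = w (h p)"
      by (simp add: w_def w2_def w3_def w4_def h_def p powr_mult wt_def a'_def c'_def q_def g_def)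
    finally show ?thesis by simp
  qed
  ultimately show ?thesis by (rule summable_on_by_injection)
qed

lemma summable_isotropic:
  assumes "\<sigma> > 3"
  shows "(\<lambda>p. maxabs p powr (-\<sigma>)) summable_on
           {(a,b,c,d,t). a * d - b * c = - t\<^sup>2 \<and> (a,b,c,d) \<noteq> (0,0,0,0)}" (is "?f summable_on ?S")
proof -
  define \<rho> where "\<rho> = \<sigma> / 3"
  have \<rho>: "\<rho> > 1" "\<sigma> = 3 * \<rho>" using assms by (auto simp: \<rho>_def)
  let ?T = "\<lambda>F::int\<Rightarrow>int. {(a,b,c,d,t). a * d - b * c = F t \<and> \<bar>c\<bar> \<le> \<bar>a\<bar> \<and> a \<noteq> 0}"
  let ?A = "?T (\<lambda>t. - t\<^sup>2)"
  let ?B = "{(a,b,c,d,t::int). a * d - b * c = - t\<^sup>2 \<and> \<bar>a\<bar> \<le> \<bar>c\<bar> \<and> c \<noteq> 0}"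
  let ?C = "{(a,b,c,d,t::int). a = 0 \<and> c = 0 \<and> t = 0 \<and> (b,d) \<noteq> (0,0)} :: (int \<times> int \<times> int \<times> int \<times> int) set"
  have A: "?f summable_on ?A" using assms by (rule summable_wide_column)
  let ?sw = "\<lambda>(a,b,c,d,t). (c,d,a,b,t) :: int \<times> int \<times> int \<times> int \<times> int"
  \<comment> \<open>Exchanging the rows moves the larger entry of the first column to the top and
    negates the determinant. This is why the preceding lemma admits an arbitrary right-hand side
    \<open>F t\<close>.\<close>
  have "?f summable_on ?T (\<lambda>t. t\<^sup>2)" using assms by (rule summable_wide_column)
  also have "?f summable_on ?T (\<lambda>t. t\<^sup>2) \<longleftrightarrow> (\<lambda>p. ?f (?sw p)) summable_on ?B"
    by (rule summable_on_reindex_bij_witness[of _ ?sw ?sw]) (auto simp: algebra_simps)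
  also have "(\<lambda>p. ?f (?sw p)) = ?f"
    by (auto simp: maxabs_swap)
  finally have B: "?f summable_on ?B" .
  \<comment> \<open>A vanishing first column forces t = 0 and leaves the pair (b, d) free. The
    quadratic bound available here is weakened to the cubic one in order to reuse
    \<open>maxabs_powr_le\<close>.\<close>
  have C: "?f summable_on ?C"
  proof (rule summable_on_by_injection)
    show "(\<lambda>p. wt \<rho> (fst p) * wt \<rho> (snd p)) summable_on UNIV"
      by (intro summable_on_Times_nonneg wt_summable \<rho>) auto
    show "inj_on (\<lambda>(a,b,c,d,t). (b,d)) ?C" by (auto simp: inj_on_def)
    fix p assume "p \<in> ?C"
    then obtain b d where p: "p = (0,b,0,d,0)" "(b,d) \<noteq> (0,0)" by auto
    define H where "H = maxabs p"
    let ?n = "\<lambda>x::int. max 1 \<bar>real_of_int x\<bar>"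
    have H: "\<bar>real_of_int b\<bar> \<le> H" "\<bar>real_of_int d\<bar> \<le> H"
      unfolding H_def p by (rule maxabs_ge)+
    have "\<bar>b\<bar> \<ge> 1 \<or> \<bar>d\<bar> \<ge> 1" using p(2) by auto
    with H have H1: "H \<ge> 1" by linarith
    have "?n b \<le> H" "?n d \<le> H" using H H1 by simp_all
    hence "?n b * ?n d \<le> H * H" using H1 by (intro mult_mono) auto
    also have "\<dots> \<le> 4 * H ^ 3"
    proof -
      have "1 * (H * H) \<le> (4 * H) * (H * H)" using H1 by (intro mult_right_mono) auto
      thus ?thesis by (simp add: power3_eq_cube mult_ac)
    qed
    finally have "maxabs p powr (-\<sigma>) \<le> 4 powr \<rho> * (?n b * ?n d) powr (-\<rho>)"
      by (intro maxabs_powr_le) (use \<rho> H1 in \<open>auto simp: H_def\<close>)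
    thus "0 \<le> ?f p \<and> ?f p \<le> 4 powr \<rho> * (wt \<rho> (fst (case p of (a,b,c,d,t) \<Rightarrow> (b,d))) * wt \<rho> (snd (case p of (a,b,c,d,t) \<Rightarrow> (b,d))))"
      by (simp add: p powr_mult wt_def)
  qed
  have "?f summable_on (?A \<union> ?B \<union> ?C)"
    by (intro summable_on_union A B C)
  thus ?thesis
    by (rule summable_on_subset_banach) auto
qed

section \<open>The automorphy factor as a linear form\<close>

lemma siegel_H2_D:
  assumes "Z \<in> siegel_H2"
  shows "Z$2$1 = Z$1$2" "Im (Z$1$1) > 0" "Im (Z$1$1) * Im (Z$2$2) > (Im (Z$1$2))\<^sup>2"
proof -
  have "transpose Z $ 1 $ 2 = Z $ 1 $ 2"
    using assms unfolding siegel_H2_def by simp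
  thus sym: "Z$2$1 = Z$1$2" by (simp add: transpose_def)
  have pos: "v \<noteq> 0 \<Longrightarrow> v$1 * (Im (Z$1$1) * v$1 + Im (Z$1$2) * v$2) + v$2 * (Im (Z$1$2) * v$1 + Im (Z$2$2) * v$2) > 0"
    for v :: "real^2"
    using assms sym
    by (auto simp: siegel_H2_def inner_vec_def matrix_vector_mult_def sum_2 map_mat_def)
  show y1: "Im (Z$1$1) > 0"
    using pos[of "vector [1, 0]"] by (simp add: vec_eq_iff forall_2)
  have "Im (Z$1$1) * (Im (Z$1$1) * Im (Z$2$2) - (Im (Z$1$2))\<^sup>2) > 0"
    using pos[of "vector [- Im (Z$1$2), Im (Z$1$1)]"] y1
    by (simp add: vec_eq_iff forall_2 algebra_simps power2_eq_square)
  with y1 show "Im (Z$1$1) * Im (Z$2$2) > (Im (Z$1$2))\<^sup>2"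
    by (simp add: zero_less_mult_iff)
qed

text \<open>\<open>autom Z (plucker g)\<close> is \<open>det (C Z + D)\<close>, see \<open>jfac_eq_autom\<close> below.\<close>

definition autom :: "complex^2^2 \<Rightarrow> (real^2^2) \<times> real \<Rightarrow> complex" where
  "autom Z p = of_real (fst p$1$1) * (Z$1$1 * Z$2$2 - Z$1$2 * Z$1$2) + of_real (fst p$1$2) * Z$1$1
     + of_real (fst p$2$1) * Z$2$2 + of_real (fst p$2$2) + 2 * of_real (snd p) * Z$1$2"

definition isotropic :: "(real^2^2) \<times> real \<Rightarrow> bool" where
  "isotropic p \<longleftrightarrow> det (fst p) = - (snd p)\<^sup>2"

text \<open>On symmetric 2 x 2 matrices the determinant is a quadratic form of signature (1, 2), and
  \<open>orth\<close> says that X and Y are orthogonal for its polar form. The orthogonal complement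
  of the positive vector Y is negative definite, so det X >= 0 leaves only X = 0.\<close>

lemma definite_orthogonal_zero:
  fixes x1 x2 x3 y1 y2 y3 :: real
  assumes y: "y1 > 0" "y1 * y2 > y3\<^sup>2" and x: "x1 * x2 \<ge> x3\<^sup>2"
    and orth: "x1 * y2 + x2 * y1 = 2 * x3 * y3"
  shows "x1 = 0 \<and> x2 = 0 \<and> x3 = 0"
proof -
  have "y1 * y2 > 0" using y(2) zero_le_power2[of y3] by linarith
  hence y2: "y2 > 0" using y(1) by (simp add: zero_less_mult_iff)
  have "(x1 * y2 + x2 * y1)\<^sup>2 - 4 * ((x1 * x2) * (y1 * y2)) = (x1 * y2 - x2 * y1)\<^sup>2"
    by (simp add: power2_eq_square algebra_simps)
  hence "4 * ((x1 * x2) * (y1 * y2)) \<le> (x1 * y2 + x2 * y1)\<^sup>2"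
    using zero_le_power2[of "x1 * y2 - x2 * y1"] by linarith
  also have "\<dots> = 4 * (x3\<^sup>2 * y3\<^sup>2)"
    unfolding orth by (simp add: power_mult_distrib)
  finally have "(x1 * x2) * (y1 * y2) \<le> x3\<^sup>2 * y3\<^sup>2" by simp
  moreover have "x3\<^sup>2 * (y1 * y2) \<le> (x1 * x2) * (y1 * y2)"
    using x \<open>y1 * y2 > 0\<close> by (intro mult_right_mono) simp_all
  ultimately have "x3\<^sup>2 * (y1 * y2 - y3\<^sup>2) \<le> 0" by (simp add: right_diff_distrib)
  hence "x3\<^sup>2 \<le> 0" using y(2) by (simp add: mult_le_0_iff)
  hence x3: "x3 = 0" by simp
  hence e: "x1 * y2 = - (x2 * y1)" using orth by simp
  have "x1 * x2 \<ge> 0" using x x3 by simp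
  have "x2\<^sup>2 * y1 = - ((x1 * y2) * x2)" unfolding e by (simp add: power2_eq_square)
  also have "\<dots> = - ((x1 * x2) * y2)" by simp
  also have "\<dots> \<le> 0" using \<open>x1 * x2 \<ge> 0\<close> y2 by simp
  finally have "x2\<^sup>2 \<le> 0" using y(1) by (simp add: mult_le_0_iff)
  hence "x2 = 0" by simp
  with e y2 x3 show ?thesis by simp
qed

lemma autom_nonzero:
  assumes Z: "Z \<in> siegel_H2" and iso: "isotropic p" and 0: "autom Z p = 0"
  shows "p = 0"
proof -
  define P A B R t where pd: "P = fst p$1$1" "A = fst p$1$2" "B = fst p$2$1" "R = fst p$2$2" "t = snd p"
  define y1 y2 y3 where y: "y1 = Im (Z$1$1)" "y2 = Im (Z$2$2)" "y3 = Im (Z$1$2)"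
  define u1 u2 u3 where u: "u1 = Re (Z$1$1)" "u2 = Re (Z$2$2)" "u3 = Re (Z$1$2)"
  have Y: "y1 > 0" "y1 * y2 > y3\<^sup>2" using siegel_H2_D[OF Z] by (auto simp: y)
  have iso': "P * R - A * B = - (t\<^sup>2)" using iso by (simp add: isotropic_def det_2 pd)
  have "Re (autom Z p) = 0" "Im (autom Z p) = 0" using 0 by auto
  hence re: "P * (u1 * u2 - y1 * y2 - (u3 * u3 - y3 * y3)) + A * u1 + B * u2 + R + 2 * t * u3 = 0"
    and im: "P * (u1 * y2 + y1 * u2 - 2 * u3 * y3) + A * y1 + B * y2 + 2 * t * y3 = 0"
    by (auto simp: autom_def u y simp flip: pd) (simp_all add: algebra_simps)
  \<comment> \<open>If \<open>P \<noteq> 0\<close>, completing the square turns the form into \<open>P det (Z + S)\<close> with a real symmetric \<open>S\<close>;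
    after multiplication by \<open>P\<close> the argument also covers \<open>P = 0\<close>.\<close>
  have "(P * u1 + B) * (P * u2 + A) - (P * u3 - t)\<^sup>2 = P\<^sup>2 * (y1 * y2 - y3\<^sup>2)"
    using re iso' by algebra
  moreover have "P\<^sup>2 * (y1 * y2 - y3\<^sup>2) \<ge> 0" using Y by auto
  moreover have "(P * u1 + B) * y2 + (P * u2 + A) * y1 = 2 * (P * u3 - t) * y3"
    using im by algebra
  ultimately have x: "P * u1 + B = 0 \<and> P * u2 + A = 0 \<and> P * u3 - t = 0"
    by (intro definite_orthogonal_zero[OF Y]) auto
  with \<open>(P * u1 + B) * (P * u2 + A) - (P * u3 - t)\<^sup>2 = P\<^sup>2 * (y1 * y2 - y3\<^sup>2)\<close> Y
  have "P = 0" by auto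
  with x have "A = 0" "B = 0" "t = 0" by auto
  with re \<open>P = 0\<close> have "R = 0" by simp
  show ?thesis
    using \<open>P = 0\<close> \<open>A = 0\<close> \<open>B = 0\<close> \<open>t = 0\<close> \<open>R = 0\<close>
    by (auto simp: prod_eq_iff vec_eq_iff forall_2 simp flip: pd)
qed

lemma autom_scaleR: "autom Z (r *\<^sub>R p) = of_real r * autom Z p"
  by (simp add: autom_def algebra_simps)

lemma autom_minus: "autom Z (- p) = - autom Z p"
  using autom_scaleR[of Z "-1" p] by simp

lemma isotropic_scaleR: "isotropic p \<Longrightarrow> isotropic (r *\<^sub>R p)"
  by (simp add: isotropic_def det_2) algebra

lemma autom_lower_bound:
  assumes Z: "Z \<in> siegel_H2"
  obtains c where "c > 0" "\<And>p. isotropic p \<Longrightarrow> c * norm p \<le> cmod (autom Z p)"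
proof -
  define K where "K = sphere 0 1 \<inter> {p. isotropic p}"
  have "closed {p :: (real^2^2) \<times> real. det (fst p) = - (snd p)\<^sup>2}"
    unfolding det_2 by (intro closed_Collect_eq continuous_intros)
  hence K: "compact K"
    unfolding K_def isotropic_def by (intro compact_Int_closed) auto
  have cont: "continuous_on K (\<lambda>p. cmod (autom Z p))"
    unfolding autom_def by (intro continuous_intros)
  have "(\<exists>c>0. \<forall>p\<in>K. c \<le> cmod (autom Z p))"
  proof (cases "K = {}")
    case False
    then obtain q where q: "q \<in> K" "\<And>p. p \<in> K \<Longrightarrow> cmod (autom Z q) \<le> cmod (autom Z p)"
      using continuous_attains_inf[OF K _ cont] by auto
    have "q \<noteq> 0" using q by (auto simp: K_def)
    moreover have "isotropic q" using q(1) by (simp add: K_def)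
    ultimately have "autom Z q \<noteq> 0" using autom_nonzero[OF Z] by blast
    thus ?thesis using q by (intro exI[of _ "cmod (autom Z q)"]) auto
  qed (auto intro: exI[of _ 1])
  then obtain c where c: "c > 0" "\<And>p. p \<in> K \<Longrightarrow> c \<le> cmod (autom Z p)" by auto
  show ?thesis
  proof (rule that[OF c(1)])
    fix p :: "(real^2^2) \<times> real" assume p: "isotropic p"
    show "c * norm p \<le> cmod (autom Z p)"
    proof (cases "p = 0")
      case False
      have "inverse (norm p) *\<^sub>R p \<in> K"
        using False by (auto simp: K_def intro: isotropic_scaleR p)
      hence "c \<le> cmod (autom Z (inverse (norm p) *\<^sub>R p))" by (rule c(2))
      also have "\<dots> = cmod (autom Z p) / norm p"
        by (simp add: autom_scaleR norm_mult norm_inverse divide_inverse mult.commute)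
      finally show ?thesis using False by (simp add: pos_le_divide_eq)
    qed auto
  qed
qed

section \<open>Symplectic matrices and their bottom rows\<close>

lemma vector_4 [simp]:
  "(vector [a, b, c, d] :: 'a::zero^4) $ 1 = a"
  "(vector [a, b, c, d] :: 'a::zero^4) $ 2 = b"
  "(vector [a, b, c, d] :: 'a::zero^4) $ 3 = c"
  "(vector [a, b, c, d] :: 'a::zero^4) $ 4 = d"
  by (simp_all add: vector_def)

lemma mat2_nth [simp]:
  "mat2 a b c d $ 1 $ 1 = a" "mat2 a b c d $ 1 $ 2 = b"
  "mat2 a b c d $ 2 $ 1 = c" "mat2 a b c d $ 2 $ 2 = d"
  by (simp_all add: mat2_def)

lemma map_mat_nth [simp]: "map_mat f M $ i $ j = f (M $ i $ j)"
  by (simp add: map_mat_def)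

lemma mat2_eq_iff: "M = mat2 a b c d \<longleftrightarrow> M$1$1 = a \<and> M$1$2 = b \<and> M$2$1 = c \<and> M$2$2 = d"
  by (auto simp: vec_eq_iff forall_2)

lemma mult_2_nth:
  fixes A B :: "'a::semiring_1^2^2"
  shows "(A ** B) $ i $ j = A$i$1 * B$1$j + A$i$2 * B$2$j"
  by (simp add: matrix_matrix_mult_def sum_2)

lemma mult_4_nth:
  fixes A B :: "'a::semiring_1^4^4"
  shows "(A ** B) $ i $ j = A$i$1 * B$1$j + A$i$2 * B$2$j + A$i$3 * B$3$j + A$i$4 * B$4$j"
  by (simp add: matrix_matrix_mult_def sum_4)

lemma transpose_nth [simp]: "transpose A $ i $ j = A $ j $ i"
  by (simp add: transpose_def)

lemma sympl_J_nth [simp]: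
  "sympl_J$1$1 = 0" "sympl_J$1$2 = 0" "sympl_J$1$3 = 1" "sympl_J$1$4 = 0"
  "sympl_J$2$1 = 0" "sympl_J$2$2 = 0" "sympl_J$2$3 = 0" "sympl_J$2$4 = 1"
  "sympl_J$3$1 = -1" "sympl_J$3$2 = 0" "sympl_J$3$3 = 0" "sympl_J$3$4 = 0"
  "sympl_J$4$1 = 0" "sympl_J$4$2 = -1" "sympl_J$4$3 = 0" "sympl_J$4$4 = 0"
  by (simp_all add: sympl_J_def)

lemma cross_mat_nth [simp]:
  "cross_mat A B$1$1 = A$1$1" "cross_mat A B$1$2 = 0" "cross_mat A B$1$3 = A$1$2" "cross_mat A B$1$4 = 0"
  "cross_mat A B$2$1 = 0" "cross_mat A B$2$2 = B$1$1" "cross_mat A B$2$3 = 0" "cross_mat A B$2$4 = B$1$2"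
  "cross_mat A B$3$1 = A$2$1" "cross_mat A B$3$2 = 0" "cross_mat A B$3$3 = A$2$2" "cross_mat A B$3$4 = 0"
  "cross_mat A B$4$1 = 0" "cross_mat A B$4$2 = B$2$1" "cross_mat A B$4$3 = 0" "cross_mat A B$4$4 = B$2$2"
  by (simp_all add: cross_mat_def)

lemma mat_1_nth_4 [simp]:
  "(mat 1 :: real^4^4) $ i $ j = (if i = j then 1 else 0)"
  by (simp add: mat_def)

lemma mat_1_nth_2 [simp]:
  "(mat 1 :: 'a::{zero,one}^2^2) $ i $ j = (if i = j then 1 else 0)"
  by (simp add: mat_def)

section \<open>The symplectic group and its integral subgroups\<close>

text \<open>The inverse of a symplectic matrix, read off from g^T J g = J and J^(-1) = -J. Its
  entries are entries of g up to sign, so integrality is inherited at once.\<close>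

definition sympl_inv :: "real^4^4 \<Rightarrow> real^4^4" where
  "sympl_inv g = - (sympl_J ** transpose g ** sympl_J)"

lemma sympl_inv_nth:
  "sympl_inv g$1$1 = g$3$3" "sympl_inv g$1$2 = g$4$3" "sympl_inv g$1$3 = - g$1$3" "sympl_inv g$1$4 = - g$2$3"
  "sympl_inv g$2$1 = g$3$4" "sympl_inv g$2$2 = g$4$4" "sympl_inv g$2$3 = - g$1$4" "sympl_inv g$2$4 = - g$2$4"
  "sympl_inv g$3$1 = - g$3$1" "sympl_inv g$3$2 = - g$4$1" "sympl_inv g$3$3 = g$1$1" "sympl_inv g$3$4 = g$2$1"
  "sympl_inv g$4$1 = - g$3$2" "sympl_inv g$4$2 = - g$4$2" "sympl_inv g$4$3 = g$1$2" "sympl_inv g$4$4 = g$2$2"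
  by (simp_all add: sympl_inv_def mult_4_nth)

lemma sympl_J_sq: "sympl_J ** sympl_J = - mat 1"
  by (simp add: vec_eq_iff forall_4 mult_4_nth)

lemma matrix_mult_minus_left: "(- A) ** B = - (A ** (B :: 'a::ring_1^'n^'n))"
  by (simp add: vec_eq_iff matrix_matrix_mult_def sum_negf)

lemma matrix_mult_minus_right: "A ** (- B) = - (A ** (B :: 'a::ring_1^'n^'n))"
  by (simp add: vec_eq_iff matrix_matrix_mult_def sum_negf)

lemma Sp2_sympl_inv_left: "g \<in> Sp2_real \<Longrightarrow> sympl_inv g ** g = mat 1"
  by (simp add: Sp2_real_def sympl_inv_def matrix_mult_minus_left matrix_mul_assoc[symmetric] sympl_J_sq)

lemma Sp2_sympl_inv_right: "g \<in> Sp2_real \<Longrightarrow> g ** sympl_inv g = mat 1"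
  using Sp2_sympl_inv_left matrix_left_right_inverse by blast

lemma Sp2_transpose:
  assumes "g \<in> Sp2_real"
  shows "g ** sympl_J ** transpose g = sympl_J"
proof -
  have "(g ** sympl_inv g) ** sympl_J = g ** sympl_J ** transpose g"
    by (simp add: sympl_inv_def matrix_mult_minus_left matrix_mult_minus_right
        matrix_mul_assoc[symmetric] sympl_J_sq)
  thus ?thesis by (simp add: Sp2_sympl_inv_right assms)
qed

lemma Sp2_mult: "g \<in> Sp2_real \<Longrightarrow> h \<in> Sp2_real \<Longrightarrow> g ** h \<in> Sp2_real"
proof -
  assume g: "g \<in> Sp2_real" and h: "h \<in> Sp2_real"
  have "transpose (g ** h) ** sympl_J ** (g ** h) = transpose h ** (transpose g ** sympl_J ** g) ** h"
    by (simp only: matrix_mul_assoc matrix_transpose_mul)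
  thus ?thesis using g h by (simp add: Sp2_real_def)
qed

lemma Sp2_one: "mat 1 \<in> Sp2_real"
  by (simp add: Sp2_real_def transpose_mat)

lemma Sp2_sympl_inv:
  assumes "g \<in> Sp2_real"
  shows "sympl_inv g \<in> Sp2_real"
proof -
  have "transpose (sympl_inv g) ** (transpose g ** sympl_J ** g) ** sympl_inv g
      = transpose (g ** sympl_inv g) ** sympl_J ** (g ** sympl_inv g)"
    by (simp only: matrix_mul_assoc matrix_transpose_mul)
  also have "\<dots> = sympl_J" by (simp add: Sp2_sympl_inv_right assms transpose_mat)
  finally show ?thesis using assms by (simp add: Sp2_real_def)
qed

lemma Ints_mult_4:
  fixes g h :: "real^4^4"
  shows "(\<forall>i j. g$i$j \<in> \<int>) \<Longrightarrow> (\<forall>i j. h$i$j \<in> \<int>) \<Longrightarrow> (g ** h)$i$j \<in> \<int>"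
  by (simp add: mult_4_nth)

lemma Gamma2_mult: "g \<in> Gamma2 \<Longrightarrow> h \<in> Gamma2 \<Longrightarrow> g ** h \<in> Gamma2"
  by (auto simp: Gamma2_def Sp2_mult Ints_mult_4)

lemma Gamma2_sympl_inv: "g \<in> Gamma2 \<Longrightarrow> sympl_inv g \<in> Gamma2"
  by (auto simp: Gamma2_def Sp2_sympl_inv forall_4 sympl_inv_nth)

lemma Gamma2_one: "mat 1 \<in> Gamma2"
  by (auto simp: Gamma2_def Sp2_one)

lemma blockC_eq_0_iff: "blockC g = 0 \<longleftrightarrow> g$3$1 = 0 \<and> g$3$2 = 0 \<and> g$4$1 = 0 \<and> g$4$2 = 0"
  by (auto simp: blockC_def vec_eq_iff forall_2)

lemma Gamma20_mult: "g \<in> Gamma20 \<Longrightarrow> h \<in> Gamma20 \<Longrightarrow> g ** h \<in> Gamma20"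
  by (auto simp: Gamma20_def Gamma2_mult blockC_eq_0_iff mult_4_nth)

lemma Gamma20_sympl_inv: "g \<in> Gamma20 \<Longrightarrow> sympl_inv g \<in> Gamma20"
  by (auto simp: Gamma20_def Gamma2_sympl_inv blockC_eq_0_iff sympl_inv_nth)

lemma Gamma20_one: "mat 1 \<in> Gamma20"
  by (auto simp: Gamma20_def Gamma2_one blockC_eq_0_iff)

section \<open>The symplectic form, the action on Z and its cocycles\<close>

definition sympl_form :: "'a::comm_ring_1^4 \<Rightarrow> 'a^4 \<Rightarrow> 'a" where
  "sympl_form u v = u$1 * v$3 + u$2 * v$4 - u$3 * v$1 - u$4 * v$2"

lemma Sp2_rows:
  assumes "g \<in> Sp2_real"
  shows "sympl_form (g$1) (g$3) = 1" "sympl_form (g$1) (g$4) = 0"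
    "sympl_form (g$2) (g$3) = 0" "sympl_form (g$2) (g$4) = 1" "sympl_form (g$3) (g$4) = 0"
proof -
  have "sympl_form (g$i) (g$j) = (g ** sympl_J ** transpose g) $ i $ j" for i j
    by (simp add: mult_4_nth sympl_form_def)
  hence "sympl_form (g$i) (g$j) = sympl_J $ i $ j" for i j
    by (simp add: Sp2_transpose assms)
  thus "sympl_form (g$1) (g$3) = 1" "sympl_form (g$1) (g$4) = 0"
    "sympl_form (g$2) (g$3) = 0" "sympl_form (g$2) (g$4) = 1" "sympl_form (g$3) (g$4) = 0"
    by simp_all
qed

lemma sympl_form_matrix_mult:
  assumes "g \<in> Sp2_real"
  shows "sympl_form (cmat g *v u) (cmat g *v v) = sympl_form u v"
proof -
  let ?c = "complex_of_real"
  let ?R = "\<lambda>a b. ?c ((transpose g ** sympl_J ** g) $ a $ b)"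
  have "sympl_form (cmat g *v u) (cmat g *v v) = (\<Sum>a\<in>UNIV. \<Sum>b\<in>UNIV. u$a * v$b * ?R a b)"
    by (simp add: sympl_form_def matrix_vector_mult_def sum_4 mult_4_nth) (simp add: algebra_simps)
  also have "\<dots> = (\<Sum>a\<in>UNIV. \<Sum>b\<in>UNIV. u$a * v$b * ?c (sympl_J $ a $ b))"
    using assms by (simp add: Sp2_real_def)
  also have "\<dots> = sympl_form u v"
    by (simp add: sum_4 sympl_form_def)
  finally show ?thesis .
qed

definition denom :: "real^4^4 \<Rightarrow> complex^2^2 \<Rightarrow> complex^2^2" where
  "denom g Z = cmat (blockC g) ** Z + cmat (blockD g)"

definition numer :: "real^4^4 \<Rightarrow> complex^2^2 \<Rightarrow> complex^2^2" where
  "numer g Z = cmat (blockA g) ** Z + cmat (blockB g)"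

lemma block_nth [simp]:
  "blockA g$1$1 = g$1$1" "blockA g$1$2 = g$1$2" "blockA g$2$1 = g$2$1" "blockA g$2$2 = g$2$2"
  "blockB g$1$1 = g$1$3" "blockB g$1$2 = g$1$4" "blockB g$2$1 = g$2$3" "blockB g$2$2 = g$2$4"
  "blockC g$1$1 = g$3$1" "blockC g$1$2 = g$3$2" "blockC g$2$1 = g$4$1" "blockC g$2$2 = g$4$2"
  "blockD g$1$1 = g$3$3" "blockD g$1$2 = g$3$4" "blockD g$2$1 = g$4$3" "blockD g$2$2 = g$4$4"
  by (simp_all add: blockA_def blockB_def blockC_def blockD_def)

lemma jfac_eq_det: "jfac g Z = det (denom g Z)"
  by (simp add: jfac_def denom_def)

lemma act_mult_denom:
  assumes "jfac g Z \<noteq> 0"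
  shows "act g Z ** denom g Z = numer g Z"
proof -
  have "invertible (denom g Z)" using assms by (simp add: invertible_det_nz jfac_eq_det)
  hence "denom g Z ** matrix_inv (denom g Z) = mat 1 \<and> matrix_inv (denom g Z) ** denom g Z = mat 1"
    unfolding invertible_def matrix_inv_def by (rule someI_ex)
  hence "matrix_inv (denom g Z) ** denom g Z = mat 1" ..
  thus ?thesis by (simp add: act_def denom_def numer_def matrix_mul_assoc[symmetric])
qed

text \<open>The columns of Z stacked over the identity. Applying g yields the numerator stacked over
  the denominator, so invariance of the symplectic form gives facts about g(Z) without inverting a
  matrix.\<close>

definition frame :: "complex^2^2 \<Rightarrow> 2 \<Rightarrow> complex^4" where
  "frame Z j = vector [Z$1$j, Z$2$j, if j = 1 then 1 else 0, if j = 2 then 1 else 0]"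

lemma cmat_mult_frame:
  "cmat g *v frame Z j = vector [numer g Z$1$j, numer g Z$2$j, denom g Z$1$j, denom g Z$2$j]"
  using exhaust_2[of j]
  by (auto simp: vec_eq_iff forall_4 frame_def numer_def denom_def mult_2_nth
      matrix_vector_mult_def sum_4)

text \<open>The defect V21 - V12, times the determinant of the denominator, is the symplectic
  product of the two transported columns, and this is zero for the columns attached to a symmetric
  Z. The form with a general quotient V also covers a two-step action, whose denominator is that of
  the product.\<close>

lemma quotient_symmetric:
  assumes g: "g \<in> Sp2_real" and Z: "Z$2$1 = Z$1$2" and V: "V ** denom g Z = numer g Z"
    and j: "jfac g Z \<noteq> 0"
  shows "V$2$1 = V$1$2"
proof -
  have K: "numer g Z$i$j = V$i$1 * denom g Z$1$j + V$i$2 * denom g Z$2$j" for i j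
    by (simp flip: V add: mult_2_nth)
  have "(V$2$1 - V$1$2) * jfac g Z = sympl_form (cmat g *v frame Z 1) (cmat g *v frame Z 2)"
    unfolding cmat_mult_frame
    by (simp add: sympl_form_def K jfac_eq_det det_2 algebra_simps)
  also have "\<dots> = 0" by (simp add: sympl_form_matrix_mult[OF g]) (simp add: sympl_form_def frame_def Z)
  finally show ?thesis using j by simp
qed

text \<open>Multiplicativity of the determinant for N^T S M with S symmetric, written in the entries
  so that it can be used as a rewrite rule.\<close>

lemma det_congruence:
  fixes a b c :: "'a::comm_ring_1"
  shows "(n1 * n4 - n2 * n3) * (m1 * m4 - m2 * m3) * (a * c - b\<^sup>2)
    = (n1 * (a * m1 + b * m3) + n3 * (b * m1 + c * m3)) * (n2 * (a * m2 + b * m4) + n4 * (b * m2 + c * m4))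
    - (n1 * (a * m2 + b * m4) + n3 * (b * m2 + c * m4)) * (n2 * (a * m1 + b * m3) + n4 * (b * m1 + c * m3))"
  by (simp add: power2_eq_square algebra_simps)

text \<open>Since g is real, it also preserves the pairing of the conjugate of one column with
  another. The Gram matrix of this pairing is conj Z - Z = -2i Im Z before, and M^* (conj W - W) M
  after, applying g, with W = g(Z); comparing determinants gives |det M|^2.\<close>

lemma delta_act:
  assumes g: "g \<in> Sp2_real" and Z: "Z \<in> siegel_H2" and j: "jfac g Z \<noteq> 0"
  shows "delta (act g Z) = delta Z / (cmod (jfac g Z))\<^sup>2"
proof -
  define M where "M = denom g Z"
  define K where "K = numer g Z"
  define W where "W = act g Z"
  have detM: "det M = jfac g Z" by (simp add: M_def jfac_eq_det)
  have WM: "W ** M = K" unfolding W_def M_def K_def by (rule act_mult_denom[OF j])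
  have sym: "Z$2$1 = Z$1$2" by (rule siegel_H2_D[OF Z])
  define z where "z = frame Z"
  define x :: "2 \<Rightarrow> complex^4" where
    "x = (\<lambda>j. vector [K$1$j, K$2$j, M$1$j, M$2$j])"
  define cv :: "complex^4 \<Rightarrow> complex^4" where "cv = (\<lambda>v. \<chi> i. cnj (v$i))"
  have x: "cmat g *v z j = x j" for j
    by (simp add: z_def x_def cmat_mult_frame K_def M_def)
  have cx: "cmat g *v cv (z j) = cv (x j)" for j
    unfolding x[symmetric] by (simp add: vec_eq_iff cv_def matrix_vector_mult_def)
  have h: "sympl_form (cv (x i)) (x j) = sympl_form (cv (z i)) (z j)" for i j
    using sympl_form_matrix_mult[OF g, of "cv (z i)" "z j"] by (simp add: x cx)
  have K: "K$i$j = W$i$1 * M$1$j + W$i$2 * M$2$j" for i j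
    by (simp flip: WM add: mult_2_nth)
  have Wsym: "W$2$1 = W$1$2"
    by (rule quotient_symmetric[OF g sym _ j]) (use WM in \<open>simp add: M_def K_def\<close>)
  have form: "sympl_form (cv (x i)) (x j) =
      cnj (M$1$i) * ((cnj (W$1$1) - W$1$1) * M$1$j + (cnj (W$1$2) - W$1$2) * M$2$j)
    + cnj (M$2$i) * ((cnj (W$1$2) - W$1$2) * M$1$j + (cnj (W$2$2) - W$2$2) * M$2$j)" for i j
    by (simp add: sympl_form_def x_def cv_def K Wsym algebra_simps)
  have "(cnj (det M) * det M) * ((cnj (W$1$1) - W$1$1) * (cnj (W$2$2) - W$2$2) - (cnj (W$1$2) - W$1$2)\<^sup>2)
     = sympl_form (cv (x 1)) (x 1) * sympl_form (cv (x 2)) (x 2) - sympl_form (cv (x 1)) (x 2) * sympl_form (cv (x 2)) (x 1)"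
    unfolding form det_congruence[symmetric] by (simp add: det_2)
  also have "\<dots> = (cnj (Z$1$1) - Z$1$1) * (cnj (Z$2$2) - Z$2$2) - (cnj (Z$1$2) - Z$1$2)\<^sup>2"
    unfolding h by (simp add: sympl_form_def z_def frame_def cv_def sym power2_eq_square)
  finally have "(cnj (det M) * det M) * ((cnj (W$1$1) - W$1$1) * (cnj (W$2$2) - W$2$2) - (cnj (W$1$2) - W$1$2)\<^sup>2)
     = (cnj (Z$1$1) - Z$1$1) * (cnj (Z$2$2) - Z$2$2) - (cnj (Z$1$2) - Z$1$2)\<^sup>2" .
  moreover have "cnj (det M) * det M = of_real ((cmod (det M))\<^sup>2)"
    by (metis complex_norm_square mult.commute)
  moreover have im: "(cnj (V$1$1) - V$1$1) * (cnj (V$2$2) - V$2$2) - (cnj (V$1$2) - V$1$2)\<^sup>2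
      = - 4 * of_real (delta V)" if "V$2$1 = V$1$2" for V
  proof -
    have c: "cnj w - w = - 2 * \<i> * of_real (Im w)" for w
      by (simp add: complex_eq_iff)
    show ?thesis unfolding c by (simp add: delta_def det_2 that power2_eq_square algebra_simps)
  qed
  ultimately have "of_real ((cmod (det M))\<^sup>2) * (- 4 * of_real (delta W)) = - 4 * complex_of_real (delta Z)"
    by (simp only: im[OF Wsym] im[OF sym])
  hence "of_real ((cmod (det M))\<^sup>2 * delta W) = complex_of_real (delta Z)"
    by simp
  hence "(cmod (det M))\<^sup>2 * delta W = delta Z"
    by (simp only: of_real_eq_iff)
  thus ?thesis using j by (simp add: W_def detM field_simps)
qed

lemma denom_mult: "denom (g ** h) Z = cmat (blockC g) ** numer h Z + cmat (blockD g) ** denom h Z"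
  by (simp add: denom_def numer_def vec_eq_iff forall_2 mult_2_nth mult_4_nth algebra_simps)

lemma numer_mult: "numer (g ** h) Z = cmat (blockA g) ** numer h Z + cmat (blockB g) ** denom h Z"
  by (simp add: denom_def numer_def vec_eq_iff forall_2 mult_2_nth mult_4_nth algebra_simps)

lemma denom_cocycle:
  assumes "jfac h Z \<noteq> 0"
  shows "denom (g ** h) Z = denom g (act h Z) ** denom h Z"
    and "numer (g ** h) Z = numer g (act h Z) ** denom h Z"
  unfolding denom_mult numer_mult act_mult_denom[OF assms, symmetric]
  by (simp_all add: denom_def[of g] numer_def[of g] vec_eq_iff forall_2 mult_2_nth algebra_simps)

lemma jfac_cocycle:
  assumes "jfac h Z \<noteq> 0"
  shows "jfac (g ** h) Z = jfac g (act h Z) * jfac h Z"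
  using denom_cocycle(1)[OF assms, of g] by (simp add: jfac_eq_det det_mul)

text \<open>With \<open>V = numer / denom\<close> symmetric, \<open>phi V\<close> is the determinant of the matrix with rows
  \<open>(1, -1)\<close> and \<open>(1, 1) V\<close>.\<close>

lemma phi_cocycle:
  assumes g: "g ** h \<in> Sp2_real" and Z: "Z \<in> siegel_H2"
    and j: "jfac h Z \<noteq> 0" "jfac (g ** h) Z \<noteq> 0"
  defines "M \<equiv> denom (g ** h) Z" and "K \<equiv> numer (g ** h) Z"
  shows "phi (act g (act h Z)) * (jfac g (act h Z) * jfac h Z)
    = (M$1$1 - M$2$1) * (K$1$2 + K$2$2) - (M$1$2 - M$2$2) * (K$1$1 + K$2$1)"
proof -
  define V where "V = act g (act h Z)"
  have "jfac g (act h Z) \<noteq> 0" using j jfac_cocycle by auto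
  hence "V ** denom g (act h Z) = numer g (act h Z)" unfolding V_def by (rule act_mult_denom)
  hence VM: "V ** M = K"
    unfolding M_def K_def denom_cocycle[OF j(1)] by (simp add: matrix_mul_assoc)
  have sym: "V$2$1 = V$1$2"
    by (rule quotient_symmetric[OF g siegel_H2_D(1)[OF Z] _ j(2)]) (use VM in \<open>simp add: M_def K_def\<close>)
  have K: "K$i$j = V$i$1 * M$1$j + V$i$2 * M$2$j" for i j
    by (simp flip: VM add: mult_2_nth)
  have det: "jfac g (act h Z) * jfac h Z = det M"
    using jfac_cocycle[OF j(1), of g] by (simp add: M_def jfac_eq_det)
  show ?thesis
    unfolding det V_def[symmetric] by (simp add: phi_def K det_2 sym algebra_simps)
qed

section \<open>Pluecker coordinates of the bottom rows\<close>

definition minor :: "real^4^4 \<Rightarrow> 4 \<Rightarrow> 4 \<Rightarrow> real" where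
  "minor g i j = g$3$i * g$4$j - g$3$j * g$4$i"

text \<open>Of the six minors of the bottom rows \<open>(C, D)\<close> two agree for symplectic matrices
  (\<open>minor_24\<close>). The remaining five are arranged so that \<open>cross_mat A B\<close> acts on the matrix component by
  \<open>N \<mapsto> A\<^sup>T N B\<close> and fixes the scalar component (\<open>plucker_mult_cross\<close>); the
  Pluecker relation becomes \<open>det N = - t\<^sup>2\<close>.\<close>

definition plucker :: "real^4^4 \<Rightarrow> (real^2^2) \<times> real" where
  "plucker g = (mat2 (minor g 1 2) (minor g 1 4) (minor g 3 2) (minor g 3 4), minor g 3 1)"

lemma minor_24: "g \<in> Sp2_real \<Longrightarrow> minor g 2 4 = minor g 3 1"
  using Sp2_rows(5)[of g] by (simp add: sympl_form_def minor_def algebra_simps)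

lemma jfac_eq_autom:
  assumes "g \<in> Sp2_real" "Z$2$1 = Z$1$2"
  shows "jfac g Z = autom Z (plucker g)"
proof -
  let ?c = "complex_of_real"
  have "jfac g Z = ?c (minor g 1 2) * (Z$1$1 * Z$2$2 - Z$1$2 * Z$1$2) + ?c (minor g 1 4) * Z$1$1
     + ?c (minor g 3 2) * Z$2$2 + ?c (minor g 3 4) + (?c (minor g 3 1) + ?c (minor g 2 4)) * Z$1$2"
    by (simp add: jfac_def det_2 mult_2_nth minor_def assms(2) algebra_simps)
  thus ?thesis by (simp add: autom_def plucker_def minor_24[OF assms(1)])
qed

lemma isotropic_plucker: "g \<in> Sp2_real \<Longrightarrow> isotropic (plucker g)"
proof -
  assume g: "g \<in> Sp2_real"
  have "minor g 1 2 * minor g 3 4 - minor g 1 4 * minor g 3 2 = - (minor g 3 1 * minor g 2 4)"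
    by (simp add: minor_def algebra_simps)
  thus ?thesis by (simp add: isotropic_def plucker_def det_2 minor_24[OF g] power2_eq_square)
qed

lemma plucker_mult_cross:
  assumes "det A = 1"
  shows "plucker (g ** cross_mat A B) = (transpose A ** fst (plucker g) ** B, snd (plucker g))"
proof -
  have "minor (g ** cross_mat A B) 3 1 = det A * minor g 3 1"
    by (simp add: minor_def mult_4_nth det_2 algebra_simps)
  thus ?thesis using assms
    by (simp add: plucker_def prod_eq_iff mat2_eq_iff[symmetric])
       (simp add: vec_eq_iff forall_2 minor_def mult_4_nth mult_2_nth algebra_simps)
qed

lemma plucker_cross_mat: "plucker (cross_mat A B) = (mat2 (A$2$1 * B$2$1) (A$2$1 * B$2$2) (A$2$2 * B$2$1) (A$2$2 * B$2$2), 0)"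
  by (simp add: plucker_def minor_def)

text \<open>With C = 0, left multiplication scales all minors by e = det D. The relation det A * det
  D = 1 holds between integers, so e is 1 or -1.\<close>

lemma plucker_Gamma20_mult:
  assumes "h \<in> Gamma20"
  shows "plucker (h ** g) = plucker g \<or> plucker (h ** g) = - plucker g"
proof -
  have h0: "h$3$1 = 0" "h$3$2 = 0" "h$4$1 = 0" "h$4$2 = 0" and hS: "h \<in> Sp2_real"
    and Z: "\<And>i j. h$i$j \<in> \<int>"
    using assms by (auto simp: Gamma20_def Gamma2_def blockC_eq_0_iff)
  define e where "e = h$3$3 * h$4$4 - h$3$4 * h$4$3"
  have "(h$1$1 * h$2$2 - h$1$2 * h$2$1) * e = 1"
  proof -
    have "(h$1$1 * h$2$2 - h$1$2 * h$2$1) * e = sympl_form (h$1) (h$3) * sympl_form (h$2) (h$4)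
        - sympl_form (h$1) (h$4) * sympl_form (h$2) (h$3)"
      by (simp add: sympl_form_def e_def h0 algebra_simps)
    thus ?thesis by (simp add: Sp2_rows[OF hS])
  qed
  moreover have "h$1$1 * h$2$2 - h$1$2 * h$2$1 \<in> \<int>" "e \<in> \<int>"
    unfolding e_def using Z by auto
  then obtain a b where "h$1$1 * h$2$2 - h$1$2 * h$2$1 = of_int a" "e = of_int b"
    by (auto elim!: Ints_cases)
  ultimately have "of_int (a * b) = (1 :: real)" "e = of_int b" by auto
  hence "a * b = 1" by linarith
  hence "b = 1 \<or> b = -1" by (auto simp: zmult_eq_1_iff)
  moreover have "minor (h ** g) i j = e * minor g i j" for i j
    by (simp add: minor_def mult_4_nth h0 e_def algebra_simps)
  hence "plucker (h ** g) = e *\<^sub>R plucker g"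
    by (simp add: plucker_def mat2_eq_iff vec_eq_iff forall_2)
  ultimately show ?thesis using \<open>e = of_int b\<close> by auto
qed

text \<open>The symplectic products of the two upper rows with the two lower rows form the identity
  matrix; Cauchy-Binet expands its determinant. For integral g this writes 1 as a combination of the
  lower minors, which yields primitivity.\<close>

lemma Sp2_Cauchy_Binet:
  assumes "g \<in> Sp2_real"
  defines "q \<equiv> \<lambda>i j. g$1$i * g$2$j - g$1$j * g$2$i"
  shows "q 1 2 * minor g 3 4 - q 1 3 * minor g 3 1 - q 1 4 * minor g 3 2 + q 2 3 * minor g 1 4
          + q 2 4 * minor g 2 4 + q 3 4 * minor g 1 2 = 1"
proof -
  have "q 1 2 * minor g 3 4 - q 1 3 * minor g 3 1 - q 1 4 * minor g 3 2 + q 2 3 * minor g 1 4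
          + q 2 4 * minor g 2 4 + q 3 4 * minor g 1 2
      = sympl_form (g$1) (g$3) * sympl_form (g$2) (g$4) - sympl_form (g$1) (g$4) * sympl_form (g$2) (g$3)"
    by (simp add: sympl_form_def q_def minor_def algebra_simps)
  thus ?thesis by (simp add: Sp2_rows[OF assms(1)])
qed

lemma plucker_nonzero: "g \<in> Sp2_real \<Longrightarrow> plucker g \<noteq> 0"
  using Sp2_Cauchy_Binet[of g] minor_24[of g]
  by (auto simp: plucker_def prod_eq_iff mat2_eq_iff vec_eq_iff forall_2)

text \<open>The automorphy factor is the linear form at a nonzero isotropic vector, where it cannot
  vanish.\<close>

lemma jfac_nonzero:
  assumes "g \<in> Sp2_real" "Z \<in> siegel_H2"
  shows "jfac g Z \<noteq> 0"
  using assms by (metis autom_nonzero isotropic_plucker jfac_eq_autom plucker_nonzero siegel_H2_D(1))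

definition imat :: "int \<Rightarrow> int \<Rightarrow> int \<Rightarrow> int \<Rightarrow> real^2^2" where
  "imat a b c d = mat2 (of_int a) (of_int b) (of_int c) (of_int d)"

text \<open>The four matrix entries are already coprime without t: the square of a common divisor
  divides t^2, so the divisor divides t and hence, by the Cauchy-Binet identity, 1. This makes the
  Smith form of the matrix component available.\<close>

lemma plucker_Gamma2:
  assumes g: "g \<in> Gamma2"
  obtains a b c d t where "plucker g = (imat a b c d, of_int t)" "gcd (gcd a b) (gcd c d) = 1"
    "a * d - b * c = - t\<^sup>2"
proof -
  have gS: "g \<in> Sp2_real" and gZ: "\<And>i j. g$i$j \<in> \<int>" using g by (auto simp: Gamma2_def)
  have "\<exists>n. g$i$j = of_int n" for i j
    using gZ[of i j] by (rule Ints_cases) blast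
  then obtain G where G: "\<And>i j. g$i$j = of_int (G i j)" by metis
  define m where "m i j = G 3 i * G 4 j - G 3 j * G 4 i" for i j
  define q where "q i j = G 1 i * G 2 j - G 1 j * G 2 i" for i j
  have minor: "minor g i j = of_int (m i j)" for i j by (simp add: minor_def m_def G)
  have plucker: "plucker g = (imat (m 1 2) (m 1 4) (m 3 2) (m 3 4), of_int (m 3 1))"
    by (simp add: plucker_def imat_def minor)
  have m24: "m 2 4 = m 3 1" using minor_24[OF gS] by (simp add: minor)
  have "real_of_int (m 1 2 * m 3 4 - m 1 4 * m 3 2) = real_of_int (- (m 3 1)\<^sup>2)"
    using isotropic_plucker[OF gS] by (simp add: isotropic_def plucker imat_def det_2)
  hence iso: "m 1 2 * m 3 4 - m 1 4 * m 3 2 = - (m 3 1)\<^sup>2" by (simp only: of_int_eq_iff)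
  have "real_of_int (q 1 2 * m 3 4 - q 1 3 * m 3 1 - q 1 4 * m 3 2 + q 2 3 * m 1 4
          + q 2 4 * m 3 1 + q 3 4 * m 1 2) = real_of_int 1"
    using Sp2_Cauchy_Binet[OF gS] by (simp add: minor m24 q_def G)
  hence cb: "q 1 2 * m 3 4 - q 1 3 * m 3 1 - q 1 4 * m 3 2 + q 2 3 * m 1 4
          + q 2 4 * m 3 1 + q 3 4 * m 1 2 = 1" by (simp only: of_int_eq_iff)
  define e where "e = gcd (gcd (m 1 2) (m 1 4)) (gcd (m 3 2) (m 3 4))"
  have e: "e dvd m 1 2" "e dvd m 1 4" "e dvd m 3 2" "e dvd m 3 4"
    unfolding e_def by (meson dvd_trans gcd_dvd1 gcd_dvd2)+
  hence "e * e dvd m 1 2 * m 3 4 - m 1 4 * m 3 2" by (intro dvd_diff mult_dvd_mono)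
  hence "e\<^sup>2 dvd (m 3 1)\<^sup>2" unfolding iso by (simp add: power2_eq_square)
  hence "e dvd m 3 1" by simp
  with e have "e dvd q 1 2 * m 3 4 - q 1 3 * m 3 1 - q 1 4 * m 3 2 + q 2 3 * m 1 4
          + q 2 4 * m 3 1 + q 3 4 * m 1 2" by auto
  hence "e dvd 1" by (simp only: cb)
  hence "e = 1" unfolding e_def using gcd_ge_0_int by (smt (verit, best) zdvd1_eq)
  with plucker iso show ?thesis by (intro that) (auto simp: e_def)
qed

text \<open>The lower left block of h g^(-1) consists of the symplectic products of the bottom rows
  of h with those of g. They vanish because proportional minors put all these rows in one Lagrangian
  plane.\<close>

lemma Gamma20_mult_of_plucker_eq:
  fixes g h :: "real^4^4"
  assumes g: "g \<in> Gamma2" and h: "h \<in> Gamma2" and eq: "plucker h = plucker g \<or> plucker h = - plucker g"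
  shows "\<exists>u\<in>Gamma20. h = u ** g"
proof (intro bexI)
  have gS: "g \<in> Sp2_real" and hS: "h \<in> Sp2_real" using g h by (auto simp: Gamma2_def)
  show "h = (h ** sympl_inv g) ** g"
    by (simp add: matrix_mul_assoc[symmetric] Sp2_sympl_inv_left gS)
  obtain e where e: "e = 1 \<or> e = -1" "plucker h = e *\<^sub>R plucker g"
    using eq by (metis scaleR_minus1_left scaleR_one)
  have "minor h 1 2 = e * minor g 1 2 \<and> minor h 1 4 = e * minor g 1 4 \<and> minor h 3 2 = e * minor g 3 2
     \<and> minor h 3 4 = e * minor g 3 4 \<and> minor h 3 1 = e * minor g 3 1"
    using e(2) by (simp add: plucker_def vec_eq_iff forall_2)
  moreover from this have "minor h 2 4 = e * minor g 2 4"
    by (simp add: minor_24 gS hS)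
  moreover have "minor k i i = 0" "minor k 2 1 = - minor k 1 2" "minor k 4 1 = - minor k 1 4"
    "minor k 2 3 = - minor k 3 2" "minor k 4 3 = - minor k 3 4" "minor k 1 3 = - minor k 3 1"
    "minor k 4 2 = - minor k 2 4" for k i by (simp_all add: minor_def)
  ultimately have "\<forall>i j. minor h i j = e * minor g i j"
    unfolding forall_4 by simp
  hence m: "minor h i j = e * minor g i j" for i j by blast
  obtain a b where ab: "minor g a b \<noteq> 0"
    using plucker_nonzero[OF gS] by (force simp: plucker_def prod_eq_iff mat2_eq_iff vec_eq_iff forall_2)
  \<comment> \<open>Three-term relations: the rows of \<open>h\<close> lie in the plane spanned by the bottom rows of \<open>g\<close>.\<close>
  have tri: "minor g a b * h$i$c = minor g a c * h$i$b - minor g b c * h$i$a" if i: "i = 3 \<or> i = 4" for i c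
  proof -
    have "minor h a b * h$i$c = minor h a c * h$i$b - minor h b c * h$i$a"
      using i by (auto simp: minor_def algebra_simps)
    thus ?thesis using e(1) by (auto simp: m)
  qed
  have J: "sympl_form (g$3) (g$j) = 0" "sympl_form (g$4) (g$j) = 0" if "j = 3 \<or> j = 4" for j
    using that Sp2_rows(5)[OF gS] by (auto simp: sympl_form_def algebra_simps)
  \<comment> \<open>Contracting the minors that involve column a with row j leaves a combination of
    symplectic products of the bottom rows of g.\<close>
  have z: "minor g a 1 * g$j$3 + minor g a 2 * g$j$4 - minor g a 3 * g$j$1 - minor g a 4 * g$j$2 = 0"
    if j: "j = 3 \<or> j = 4" for j a
  proof -
    have "minor g a 1 * g$j$3 + minor g a 2 * g$j$4 - minor g a 3 * g$j$1 - minor g a 4 * g$j$2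
        = g$3$a * sympl_form (g$4) (g$j) - g$4$a * sympl_form (g$3) (g$j)"
      by (simp add: minor_def sympl_form_def algebra_simps)
    thus ?thesis by (simp add: J[OF j])
  qed
  have orth: "sympl_form (h$i) (g$j) = 0" if i: "i = 3 \<or> i = 4" and j: "j = 3 \<or> j = 4" for i j
  proof -
    have "minor g a b * sympl_form (h$i) (g$j)
       = (minor g a b * h$i$1) * g$j$3 + (minor g a b * h$i$2) * g$j$4
         - (minor g a b * h$i$3) * g$j$1 - (minor g a b * h$i$4) * g$j$2"
      by (simp add: sympl_form_def algebra_simps)
    also have "\<dots> = h$i$b * (minor g a 1 * g$j$3 + minor g a 2 * g$j$4 - minor g a 3 * g$j$1 - minor g a 4 * g$j$2)
       - h$i$a * (minor g b 1 * g$j$3 + minor g b 2 * g$j$4 - minor g b 3 * g$j$1 - minor g b 4 * g$j$2)"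
      unfolding tri[OF i] by (simp add: algebra_simps)
    also have "\<dots> = 0" by (simp add: z[OF j])
    finally show ?thesis using ab by simp
  qed
  have "blockC (h ** sympl_inv g) = 0"
    using orth[of 3 3] orth[of 3 4] orth[of 4 3] orth[of 4 4]
    by (simp add: blockC_eq_0_iff mult_4_nth sympl_inv_nth sympl_form_def algebra_simps)
  thus "h ** sympl_inv g \<in> Gamma20" using g h by (simp add: Gamma20_def Gamma2_mult Gamma2_sympl_inv)
qed

section \<open>Integral normal forms and cosets\<close>

definition adj2 :: "real^2^2 \<Rightarrow> real^2^2" where
  "adj2 A = mat2 (A$2$2) (- A$1$2) (- A$2$1) (A$1$1)"

lemma adj2_left: "det A = 1 \<Longrightarrow> adj2 A ** A = mat 1"
  by (simp add: adj2_def vec_eq_iff forall_2 mult_2_nth det_2 algebra_simps)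

lemma adj2_right: "det A = 1 \<Longrightarrow> A ** adj2 A = mat 1"
  by (simp add: adj2_def vec_eq_iff forall_2 mult_2_nth det_2 algebra_simps)

lemma det_adj2: "det (adj2 A) = det A"
  by (simp add: adj2_def det_2)

lemma SL2Z_det: "A \<in> SL2Z \<Longrightarrow> det A = 1"
  by (simp add: SL2Z_def)

lemma SL2Z_mult: "A \<in> SL2Z \<Longrightarrow> B \<in> SL2Z \<Longrightarrow> A ** B \<in> SL2Z"
  by (simp add: SL2Z_def det_mul mult_2_nth)

lemma SL2Z_one: "mat 1 \<in> SL2Z"
  by (simp add: SL2Z_def det_2)

lemma SL2Z_transpose: "A \<in> SL2Z \<Longrightarrow> transpose A \<in> SL2Z"
  by (simp add: SL2Z_def det_transpose)

lemma SL2Z_adj2: "A \<in> SL2Z \<Longrightarrow> adj2 A \<in> SL2Z"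
  by (simp add: SL2Z_def det_adj2 forall_2) (simp add: adj2_def)

text \<open>Its determinant -1 makes \<open>(swap2, 1)\<close> isotropic. Conjugation by it
  preserves \<open>SL2Z\<close>, which allows unimodular factors to be moved across it.\<close>

definition swap2 :: "real^2^2" where
  "swap2 = mat2 0 1 1 0"

lemma swap2_swap2: "swap2 ** swap2 = mat 1"
  by (simp add: swap2_def vec_eq_iff forall_2 mult_2_nth)

lemma transpose_swap2: "transpose swap2 = swap2"
  by (simp add: swap2_def vec_eq_iff forall_2)

lemma det_swap2: "det swap2 = - 1"
  by (simp add: swap2_def det_2)

lemma SL2Z_conj_swap2: "A \<in> SL2Z \<Longrightarrow> swap2 ** A ** swap2 \<in> SL2Z"
  by (simp add: SL2Z_def det_mul det_swap2 forall_2) (simp add: swap2_def mult_2_nth)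

lemma imat_nth [simp]:
  "imat a b c d $1$1 = of_int a" "imat a b c d $1$2 = of_int b"
  "imat a b c d $2$1 = of_int c" "imat a b c d $2$2 = of_int d"
  by (simp_all add: imat_def)

lemma det_imat: "det (imat a b c d) = of_int (a * d - b * c)"
  by (simp add: det_2)

lemma imat_SL2Z: "a * d - b * c = 1 \<Longrightarrow> imat a b c d \<in> SL2Z"
  by (simp add: SL2Z_def det_imat forall_2)

lemma imat_mult:
  "imat a b c d ** imat a' b' c' d'
    = imat (a * a' + b * c') (a * b' + b * d') (c * a' + d * c') (c * b' + d * d')"
  by (simp add: vec_eq_iff forall_2 mult_2_nth)

section \<open>Smith normal form of a primitive matrix\<close>

definition smith_reducible :: "real^2^2 \<Rightarrow> bool" where
  "smith_reducible M \<longleftrightarrow> (\<exists>U\<in>SL2Z. \<exists>V\<in>SL2Z. \<exists>n. M = U ** imat n 0 0 1 ** V)"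

lemma smith_reducible_left:
  assumes A: "A \<in> SL2Z" and r: "smith_reducible (A ** M)"
  shows "smith_reducible M"
proof -
  obtain U V n where UV: "U \<in> SL2Z" "V \<in> SL2Z" "A ** M = U ** imat n 0 0 1 ** V"
    using r unfolding smith_reducible_def by blast
  have "M = adj2 A ** (A ** M)"
    using A by (simp add: matrix_mul_assoc adj2_left SL2Z_det)
  also have "\<dots> = (adj2 A ** U) ** imat n 0 0 1 ** V"
    unfolding UV(3) by (simp only: matrix_mul_assoc)
  finally show ?thesis unfolding smith_reducible_def
    using A UV SL2Z_adj2 SL2Z_mult by blast
qed

lemma smith_reducible_right:
  assumes A: "A \<in> SL2Z" and r: "smith_reducible (M ** A)"
  shows "smith_reducible M"
proof -
  obtain U V n where UV: "U \<in> SL2Z" "V \<in> SL2Z" "M ** A = U ** imat n 0 0 1 ** V"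
    using r unfolding smith_reducible_def by blast
  have "M = (M ** A) ** adj2 A"
    using A by (simp add: matrix_mul_assoc[symmetric] adj2_right SL2Z_det)
  also have "\<dots> = U ** imat n 0 0 1 ** (V ** adj2 A)"
    unfolding UV(3) by (simp only: matrix_mul_assoc)
  finally show ?thesis unfolding smith_reducible_def
    using A UV SL2Z_adj2 SL2Z_mult by blast
qed

text \<open>A Bezout relation gives a row operation that turns the right column into (0, 1); a
  column operation then clears the entry to the left of the 1.\<close>

lemma smith_reducible_column:
  assumes "coprime b d"
  shows "smith_reducible (imat a b c d)"
proof -
  obtain u v where uv: "u * b + v * d = 1"
    using assms bezout_int[of b d] by (metis coprime_iff_gcd_eq_1)
  have A: "imat d (- b) u v \<in> SL2Z" by (rule imat_SL2Z) (use uv in \<open>simp add: algebra_simps\<close>)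
  have B: "imat 1 0 (- (u * a + v * c)) 1 \<in> SL2Z" by (rule imat_SL2Z) simp
  have "imat d (- b) u v ** imat a b c d = imat (d * a - b * c) 0 (u * a + v * c) 1"
    using uv by (simp add: imat_mult algebra_simps)
  hence "imat d (- b) u v ** imat a b c d ** imat 1 0 (- (u * a + v * c)) 1
     = mat 1 ** imat (d * a - b * c) 0 0 1 ** mat 1"
    by (simp add: imat_mult)
  hence "smith_reducible (imat d (- b) u v ** imat a b c d ** imat 1 0 (- (u * a + v * c)) 1)"
    unfolding smith_reducible_def using SL2Z_one by blast
  thus ?thesis
    using A B smith_reducible_left smith_reducible_right by blast
qed

text \<open>The product of the primes dividing \<open>d\<close> but not \<open>b\<close> serves as \<open>x\<close>.\<close>

lemma exists_coprime_shift:
  fixes b d g :: int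
  assumes gcd: "gcd (gcd g b) d = 1" and d: "d \<noteq> 0"
  shows "\<exists>x. coprime (b + g * x) d"
proof -
  define x where "x = \<Prod>{p \<in> prime_factors d. \<not> p dvd b}"
  have "coprime (b + g * x) d"
  proof (rule ccontr)
    assume "\<not> coprime (b + g * x) d"
    hence "gcd (b + g * x) d \<noteq> 1" by (simp add: coprime_iff_gcd_eq_1)
    moreover have "gcd (b + g * x) d \<noteq> 0" using d by simp
    ultimately obtain p where p: "prime p" "p dvd gcd (b + g * x) d"
      by (metis prime_divisor_exists is_unit_gcd_iff)
    hence pd: "p dvd d" and ps: "p dvd b + g * x" by auto
    show False
    proof (cases "p dvd b")
      case True
      hence "p dvd g * x" using ps by (simp add: dvd_add_right_iff)
      moreover have "\<not> p dvd g"
        using True pd gcd p(1) by (metis gcd_greatest not_prime_unit)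
      ultimately have "p dvd x" using p(1) by (simp add: prime_dvd_mult_iff)
      then obtain q where q: "q \<in> prime_factors d" "\<not> q dvd b" "p dvd q"
        using p(1) unfolding x_def by (subst (asm) prime_dvd_prod_iff) auto
      hence "p = q" using p(1) primes_dvd_imp_eq by (metis in_prime_factors_imp_prime)
      thus False using q True by simp
    next
      case False
      have "p \<in> {p \<in> prime_factors d. \<not> p dvd b}"
        using False pd p(1) d by (simp add: prime_factors_dvd)
      hence "p dvd x" unfolding x_def by (intro dvd_prodI) auto
      thus False using ps False by (metis dvd_add_left_iff dvd_mult)
    qed
  qed
  thus ?thesis ..
qed

text \<open>Row operations make the matrix upper triangular; adding a multiple of the first column
  to the second then makes the second column coprime.\<close>

lemma smith_reducible_primitive:
  assumes gcd: "gcd (gcd a b) (gcd c d) = 1"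
  shows "smith_reducible (imat a b c d)"
proof (cases "a = 0 \<and> c = 0")
  case True
  thus ?thesis using gcd by (intro smith_reducible_column) (simp add: coprime_iff_gcd_eq_1)
next
  case False
  define g where "g = gcd a c"
  have g0: "g \<noteq> 0" using False by (simp add: g_def)
  obtain u v where uv: "u * a + v * c = g" using bezout_int[of a c] by (auto simp: g_def)
  obtain a' c' where ac: "a = g * a'" "c = g * c'"
    using gcd_dvd1[of a c] gcd_dvd2[of a c] unfolding g_def dvd_def by blast
  have "g * (u * a' + v * c') = g * 1" using uv ac by (simp add: algebra_simps)
  hence uv': "u * a' + v * c' = 1" using g0 by (simp only: mult_cancel_left) simp
  define b' d' where b'd': "b' = u * b + v * d" "d' = a' * d - c' * b"
  have A: "imat u v (- c') a' \<in> SL2Z" by (rule imat_SL2Z) (use uv' in \<open>simp add: algebra_simps\<close>)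
  have AM: "imat u v (- c') a' ** imat a b c d = imat g b' 0 d'"
    using uv by (simp add: imat_mult b'd' ac algebra_simps)
  have "gcd (gcd g b') d' dvd 1"
  proof -
    define e where "e = gcd (gcd g b') d'"
    have e: "e dvd g" "e dvd b'" "e dvd d'"
      unfolding e_def by (meson dvd_trans gcd_dvd1 gcd_dvd2)+
    have "b = (u * a' + v * c') * b" "d = (u * a' + v * c') * d" by (simp_all add: uv')
    hence "b = a' * b' - v * d'" "d = c' * b' + u * d'"
      by (simp_all add: b'd' algebra_simps)
    hence "e dvd b" "e dvd d" using e by simp_all
    moreover have "e dvd a" "e dvd c" using e ac by simp_all
    ultimately have "e dvd gcd (gcd a b) (gcd c d)" by simp
    thus ?thesis by (simp add: gcd e_def)
  qed
  hence gcd': "gcd (gcd g b') d' = 1" by simp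
  have "smith_reducible (imat g b' 0 d')"
  \<comment> \<open>The coprime shift needs d' nonzero. For d' = 0 the row (g, b') is itself
    primitive, and a unimodular column operation carries it to (0, 1).\<close>
  proof (cases "d' = 0")
    case True
    hence "gcd g b' = 1" using gcd' by simp
    then obtain x y where xy: "x * g + y * b' = 1" using bezout_int[of g b'] by auto
    have V: "imat b' x (- g) y \<in> SL2Z" by (rule imat_SL2Z) (use xy in \<open>simp add: algebra_simps\<close>)
    have "imat g b' 0 d' ** imat b' x (- g) y = imat 0 1 0 0"
      using xy True by (simp add: imat_mult algebra_simps)
    hence "smith_reducible (imat g b' 0 d' ** imat b' x (- g) y)"
      using smith_reducible_column by simp
    thus ?thesis using V smith_reducible_right by blast
  next
    case False
    then obtain x where x: "coprime (b' + g * x) d'" using exists_coprime_shift[OF gcd'] by blast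
    have V: "imat 1 x 0 1 \<in> SL2Z" by (rule imat_SL2Z) simp
    have "imat g b' 0 d' ** imat 1 x 0 1 = imat g (b' + g * x) 0 d'"
      by (simp add: imat_mult algebra_simps)
    hence "smith_reducible (imat g b' 0 d' ** imat 1 x 0 1)"
      using smith_reducible_column[OF x] by simp
    thus ?thesis using V smith_reducible_right by blast
  qed
  thus ?thesis using A AM smith_reducible_left by metis
qed

lemma smith_form:
  assumes gcd: "gcd (gcd a b) (gcd c d) = 1"
  obtains U V where "U \<in> SL2Z" "V \<in> SL2Z" "imat a b c d = U ** imat (a * d - b * c) 0 0 1 ** V"
proof -
  obtain U V n where UV: "U \<in> SL2Z" "V \<in> SL2Z" and M: "imat a b c d = U ** imat n 0 0 1 ** V"
    using smith_reducible_primitive[OF gcd] unfolding smith_reducible_def by blast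
  have "det (imat a b c d) = det (imat n 0 0 1)"
    unfolding M det_mul using UV by (simp add: SL2Z_det)
  hence "of_int (a * d - b * c) = (of_int n :: real)" by (simp only: det_imat)
  hence "n = a * d - b * c" by (simp only: of_int_eq_iff)
  with UV M that show ?thesis by blast
qed

text \<open>The antidiagonal shape is chosen because it equals m times diag(m, 1/m) times
  \<open>swap2\<close> when t = m, which is how the Hecke double coset enters.\<close>

lemma smith_form_minus_square:
  assumes "gcd (gcd a b) (gcd c d) = 1" "a * d - b * c = - t\<^sup>2"
  obtains U V where "U \<in> SL2Z" "V \<in> SL2Z" "imat a b c d = U ** imat 0 (t\<^sup>2) 1 0 ** V"
proof -
  obtain U V where UV: "U \<in> SL2Z" "V \<in> SL2Z" "imat a b c d = U ** imat (a * d - b * c) 0 0 1 ** V"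
    using smith_form[OF assms(1)] .
  have S: "imat 0 1 (-1) 0 \<in> SL2Z" by (rule imat_SL2Z) simp
  have "imat (a * d - b * c) 0 0 1 = imat 0 (t\<^sup>2) 1 0 ** imat 0 1 (-1) 0"
    by (simp add: imat_mult assms(2))
  hence "imat a b c d = U ** imat 0 (t\<^sup>2) 1 0 ** (imat 0 1 (-1) 0 ** V)"
    unfolding UV(3) by (simp only: matrix_mul_assoc)
  thus ?thesis using that UV S SL2Z_mult by blast
qed

section \<open>Realising primitive isotropic vectors\<close>

lemma cross_mat_Sp2:
  assumes "det A = 1" "det B = 1"
  shows "cross_mat A B \<in> Sp2_real"
proof -
  have "A$1$1 * A$2$2 - A$1$2 * A$2$1 = 1" "B$1$1 * B$2$2 - B$1$2 * B$2$1 = 1"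
    using assms by (simp_all add: det_2)
  thus ?thesis
    by (simp add: Sp2_real_def vec_eq_iff forall_4 mult_4_nth algebra_simps)
qed

lemma cross_mat_Gamma2: "A \<in> SL2Z \<Longrightarrow> B \<in> SL2Z \<Longrightarrow> cross_mat A B \<in> Gamma2"
  by (simp add: Gamma2_def cross_mat_Sp2 SL2Z_det forall_4) (simp add: SL2Z_def)

text \<open>The two bottom rows span a Lagrangian whose Pluecker vector is in normal form; the upper
  rows complete them to an integral symplectic matrix.\<close>

definition base_point :: "int \<Rightarrow> real^4^4" where
  "base_point t = vector [vector [1, 0, 0, 0], vector [0, 0, 0, -1],
     vector [0, 0, 1, - of_int t], vector [of_int t, 1, 0, 0]]"

lemma base_point_Gamma2: "base_point t \<in> Gamma2"
  by (simp add: Gamma2_def Sp2_real_def vec_eq_iff forall_4 mult_4_nth base_point_def)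

lemma plucker_base_point: "plucker (base_point t) = (imat 0 (t\<^sup>2) 1 0, of_int t)"
  by (simp add: plucker_def imat_def minor_def base_point_def power2_eq_square)

lemma plucker_surj:
  assumes "U \<in> SL2Z" "V \<in> SL2Z"
  shows "\<exists>g\<in>Gamma2. plucker g = (U ** imat 0 (t\<^sup>2) 1 0 ** V, of_int t)"
proof
  show "plucker (base_point t ** cross_mat (transpose U) V) = (U ** imat 0 (t\<^sup>2) 1 0 ** V, of_int t)"
    using assms by (simp add: plucker_mult_cross SL2Z_det det_transpose plucker_base_point)
  show "base_point t ** cross_mat (transpose U) V \<in> Gamma2"
    using assms by (intro Gamma2_mult base_point_Gamma2 cross_mat_Gamma2 SL2Z_transpose)
qed

section \<open>Cosets and their representatives\<close>

definition matrix_group :: "(real^'n^'n) set \<Rightarrow> bool" where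
  "matrix_group H \<longleftrightarrow> mat 1 \<in> H \<and> (\<forall>a\<in>H. \<forall>b\<in>H. a ** b \<in> H) \<and> (\<forall>a\<in>H. \<exists>b\<in>H. b ** a = mat 1)"

abbreviation right_coset :: "(real^'n^'n) set \<Rightarrow> real^'n^'n \<Rightarrow> (real^'n^'n) set" where
  "right_coset H g \<equiv> (\<lambda>h. h ** g) ` H"

lemma right_coset_mult:
  assumes H: "matrix_group H" and h: "h \<in> H"
  shows "right_coset H (h ** g) = right_coset H g"
proof
  show "right_coset H (h ** g) \<subseteq> right_coset H g"
    using H h by (force simp: matrix_group_def matrix_mul_assoc)
  obtain k where k: "k \<in> H" "k ** h = mat 1" using H h unfolding matrix_group_def by blast
  show "right_coset H g \<subseteq> right_coset H (h ** g)"
  proof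
    fix x assume "x \<in> right_coset H g"
    then obtain a where a: "a \<in> H" "x = a ** g" by blast
    have "(a ** k) ** (h ** g) = a ** (k ** h) ** g" by (simp only: matrix_mul_assoc)
    hence "x = (a ** k) ** (h ** g)" using a k by simp
    moreover have "a ** k \<in> H" using a k H unfolding matrix_group_def by blast
    ultimately show "x \<in> right_coset H (h ** g)" by blast
  qed
qed

lemma right_coset_self: "matrix_group H \<Longrightarrow> g \<in> right_coset H g"
  by (force simp: matrix_group_def image_iff intro!: bexI[of _ "mat 1"])

lemma right_coset_eqD:
  assumes "matrix_group H" "right_coset H g = right_coset H g'"
  shows "\<exists>h\<in>H. g' = h ** g"
  using right_coset_self[OF assms(1), of g'] assms(2) by blast

lemma coset_rep_right_coset:
  assumes "matrix_group H"
  shows "\<exists>h\<in>H. coset_rep (right_coset H g) = h ** g"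
proof -
  have "coset_rep (right_coset H g) \<in> right_coset H g"
    unfolding coset_rep_def using right_coset_self[OF assms] by (rule someI)
  thus ?thesis by blast
qed

lemma left_quot_rep:
  assumes H: "matrix_group H" and S: "\<And>h g. h \<in> H \<Longrightarrow> g \<in> S \<Longrightarrow> h ** g \<in> S" and c: "c \<in> left_quot H S"
  shows "coset_rep c \<in> S" "right_coset H (coset_rep c) = c"
proof -
  obtain g where g: "g \<in> S" "c = right_coset H g" using c unfolding left_quot_def by blast
  obtain h where h: "h \<in> H" "coset_rep c = h ** g" using coset_rep_right_coset[OF H] g(2) by blast
  show "coset_rep c \<in> S" using h g S by simp
  show "right_coset H (coset_rep c) = c" using h g right_coset_mult[OF H] by simp
qed

lemma right_coset_in_left_quot: "g \<in> S \<Longrightarrow> right_coset H g \<in> left_quot H S"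
  by (simp add: left_quot_def)

lemma matrix_group_Gamma20: "matrix_group Gamma20"
proof -
  have "\<exists>b\<in>Gamma20. b ** a = mat 1" if "a \<in> Gamma20" for a
    using that Gamma20_sympl_inv[OF that] Sp2_sympl_inv_left[of a] by (auto simp: Gamma20_def Gamma2_def)
  thus ?thesis by (simp add: matrix_group_def Gamma20_one Gamma20_mult)
qed

lemma matrix_group_SL2Z: "matrix_group SL2Z"
  unfolding matrix_group_def using SL2Z_one SL2Z_mult SL2Z_adj2 SL2Z_det adj2_left by blast

lemma matrix_group_SL2Z_inf: "matrix_group SL2Z_inf"
proof -
  have "mat 1 \<in> SL2Z_inf" by (simp add: SL2Z_inf_def SL2Z_one)
  moreover have "a ** b \<in> SL2Z_inf" if "a \<in> SL2Z_inf" "b \<in> SL2Z_inf" for a b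
    using that by (simp add: SL2Z_inf_def SL2Z_mult mult_2_nth)
  moreover have "adj2 a \<in> SL2Z_inf \<and> adj2 a ** a = mat 1" if "a \<in> SL2Z_inf" for a
    using that by (simp add: SL2Z_inf_def SL2Z_adj2 adj2_left SL2Z_det) (simp add: adj2_def)
  ultimately show ?thesis unfolding matrix_group_def by blast
qed

lemma Gamma20_Gamma2: "h \<in> Gamma20 \<Longrightarrow> g \<in> Gamma2 \<Longrightarrow> h ** g \<in> Gamma2"
  by (simp add: Gamma20_def Gamma2_mult)

lemma SL2Z_inf_SL2Z: "h \<in> SL2Z_inf \<Longrightarrow> g \<in> SL2Z \<Longrightarrow> h ** g \<in> SL2Z"
  by (simp add: SL2Z_inf_def SL2Z_mult)

lemma right_coset_Gamma20_eq_iff: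
  assumes "g \<in> Gamma2" "h \<in> Gamma2"
  shows "right_coset Gamma20 g = right_coset Gamma20 h \<longleftrightarrow> plucker h = plucker g \<or> plucker h = - plucker g"
proof
  assume "right_coset Gamma20 g = right_coset Gamma20 h"
  then obtain u where "u \<in> Gamma20" "h = u ** g"
    using right_coset_eqD[OF matrix_group_Gamma20] by blast
  thus "plucker h = plucker g \<or> plucker h = - plucker g" using plucker_Gamma20_mult by blast
next
  assume "plucker h = plucker g \<or> plucker h = - plucker g"
  then obtain u where "u \<in> Gamma20" "h = u ** g" using Gamma20_mult_of_plucker_eq[OF assms] by blast
  thus "right_coset Gamma20 g = right_coset Gamma20 h"
    using right_coset_mult[OF matrix_group_Gamma20] by simp
qed

lemma plucker_coset_rep:
  "plucker (coset_rep (right_coset Gamma20 g)) = plucker g \<or> plucker (coset_rep (right_coset Gamma20 g)) = - plucker g"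
  using coset_rep_right_coset[OF matrix_group_Gamma20, of g] plucker_Gamma20_mult by metis

section \<open>The Eisenstein series as a sum over cosets\<close>

text \<open>The common shape of \<open>Phi\<close> and \<open>chi\<close>, as a multiplicative
  function of one complex number. Multiplicativity lets identities between automorphy factors pass
  to the summands.\<close>

definition weight_pow :: "int \<Rightarrow> complex \<Rightarrow> complex \<Rightarrow> complex" where
  "weight_pow k s x = x powi (- k) * complex_of_real (cmod x) powr (- 2 * s)"

lemma weight_pow_mult: "weight_pow k s (x * y) = weight_pow k s x * weight_pow k s y"
  by (simp add: weight_pow_def power_int_mult_distrib norm_mult powr_times_real)

lemma Phi_eq_weight_pow: "Phi k s Z = weight_pow k s (phi Z)"
  by (simp add: Phi_def weight_pow_def)

lemma chi_eq_weight_pow: "chi k s g Z = weight_pow k s (jfac g Z)"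
  by (simp add: chi_def weight_pow_def)

lemma weight_pow_minus: "even k \<Longrightarrow> weight_pow k s (- x) = weight_pow k s x"
  by (simp add: weight_pow_def power_int_minus_left)

lemma norm_weight_pow:
  assumes "x \<noteq> 0"
  shows "cmod (weight_pow k s x) = cmod x powr (- (2 * Re s + of_int k))"
proof -
  have "cmod (weight_pow k s x) = cmod x powi (- k) * cmod x powr (- 2 * Re s)"
    using assms by (simp add: weight_pow_def norm_mult norm_power_int norm_powr_real_powr)
  also have "cmod x powi (- k) = cmod x powr (of_int (- k))"
    using assms by (intro powr_real_of_int'[symmetric]) auto
  also have "\<dots> * cmod x powr (- 2 * Re s) = cmod x powr (of_int (- k) + - 2 * Re s)"
    by (rule powr_add[symmetric])
  finally show ?thesis by (simp add: algebra_simps)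
qed

lemma weight_pow_of_nat:
  assumes "m > 0"
  shows "of_nat m powr (- 2 * s - of_int k) = weight_pow k s (of_nat m)"
proof -
  have e: "- 2 * s - of_int k = of_int (- k) + - 2 * s" by simp
  have "(of_nat m :: complex) powr (- 2 * s - of_int k) = of_nat m powr (of_int (- k)) * of_nat m powr (- 2 * s)"
    unfolding e by (rule powr_add)
  also have "(of_nat m :: complex) powr (of_int (- k)) = of_nat m powi (- k)"
    using assms by (subst powr_of_int) (auto simp: power_int_def power_inverse)
  finally show ?thesis by (simp add: weight_pow_def)
qed

lemma of_real_powr_eq_exp: "r > 0 \<Longrightarrow> complex_of_real r powr s = exp (s * of_real (ln r))"
  by (simp add: powr_def Ln_of_real)

text \<open>All bases of \<open>powr\<close> are positive reals, so their logarithms are real and no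
  branch of the complex logarithm interferes.\<close>

lemma powr_quotient_square:
  assumes "d > 0" "x \<noteq> 0"
  shows "x powi (- k) * complex_of_real (d / (cmod x)\<^sup>2) powr s = of_real d powr s * weight_pow k s x"
proof -
  have "ln (d / (cmod x)\<^sup>2) = ln d - 2 * ln (cmod x)"
    using assms by (simp add: ln_div ln_realpow)
  moreover have "d / (cmod x)\<^sup>2 > 0" using assms by simp
  ultimately show ?thesis using assms
    by (simp add: weight_pow_def of_real_powr_eq_exp del: of_real_divide)
       (simp add: algebra_simps flip: exp_add)
qed

lemma delta_pos: "Z \<in> siegel_H2 \<Longrightarrow> delta Z > 0"
  using siegel_H2_D[of Z] by (simp add: delta_def det_2 power2_eq_square)

definition eis_term :: "int \<Rightarrow> complex \<Rightarrow> complex^2^2 \<Rightarrow> (real^2^2) \<times> real \<Rightarrow> complex" where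
  "eis_term k s Z p = weight_pow k s (autom Z p)"

lemma eis_term_minus: "even k \<Longrightarrow> eis_term k s Z (- p) = eis_term k s Z p"
  by (simp add: eis_term_def autom_minus weight_pow_minus)

lemma slash_delta_powr:
  assumes "g \<in> Sp2_real" "Z \<in> siegel_H2"
  shows "jfac g Z powi (- k) * complex_of_real (delta (act g Z)) powr s
    = of_real (delta Z) powr s * weight_pow k s (jfac g Z)"
  unfolding delta_act[OF assms jfac_nonzero[OF assms]]
  by (rule powr_quotient_square[OF delta_pos[OF assms(2)] jfac_nonzero[OF assms]])

lemma upper_lower_emb: "upper_emb A ** lower_emb B = cross_mat A B"
  by (simp add: upper_emb_def lower_emb_def vec_eq_iff forall_4 mult_4_nth)

lemma lower_upper_emb: "lower_emb B ** upper_emb A = cross_mat A B"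
  by (simp add: upper_emb_def lower_emb_def vec_eq_iff forall_4 mult_4_nth)

lemma weight_pow_jfac:
  assumes "g \<in> Sp2_real" "Z \<in> siegel_H2"
  shows "weight_pow k s (jfac g Z) = eis_term k s Z (plucker g)"
  by (simp add: eis_term_def jfac_eq_autom[OF assms(1) siegel_H2_D(1)[OF assms(2)]])

text \<open>The Pluecker vector of the Lagrangian that belongs to the pair \<open>(A, B)\<close>; the factor \<open>m\<close>
  makes it integral and primitive when \<open>A\<close> lies in the double coset of \<open>diag (m, 1/m)\<close>.\<close>

definition graph_plucker :: "nat \<Rightarrow> real^2^2 \<Rightarrow> real^2^2 \<Rightarrow> (real^2^2) \<times> real" where
  "graph_plucker m A B = (real m *\<^sub>R (transpose A ** swap2 ** B), real m)"

text \<open>\<open>phi\<close> is the linear form at \<open>(swap2, 1)\<close>. Moving Z by the pair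
  (A, B) and clearing the automorphy factors amounts to moving this vector by N |-> A^T N B.\<close>

lemma phi_autom:
  assumes Z: "Z \<in> siegel_H2" and A: "det A = 1" and B: "det B = 1"
  shows "phi (act (lower_emb B) (act (upper_emb A) Z)) * (jfac (lower_emb B) (act (upper_emb A) Z)
      * jfac (upper_emb A) Z) = autom Z (transpose A ** swap2 ** B, 1)"
proof -
  have sp: "cross_mat A B \<in> Sp2_real" "upper_emb A \<in> Sp2_real"
    using A B by (simp_all add: upper_emb_def cross_mat_Sp2)
  have sym: "Z$2$1 = Z$1$2" by (rule siegel_H2_D(1)[OF Z])
  have "phi (act (lower_emb B) (act (upper_emb A) Z)) * (jfac (lower_emb B) (act (upper_emb A) Z)
      * jfac (upper_emb A) Z) = (let M = denom (cross_mat A B) Z; K = numer (cross_mat A B) Z in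
      (M$1$1 - M$2$1) * (K$1$2 + K$2$2) - (M$1$2 - M$2$2) * (K$1$1 + K$2$1))"
    using phi_cocycle[of "lower_emb B" "upper_emb A" Z] sp Z
    by (simp add: Let_def lower_upper_emb jfac_nonzero)
  \<comment> \<open>The coefficient \<open>det A + det B\<close> is 2, as the scalar component 1
    requires in \<open>autom\<close>.\<close>
  also have "\<dots> = of_real (det A + det B) * Z$1$2 + of_real (A$2$1 * B$1$1 + A$1$1 * B$2$1) * (Z$1$1 * Z$2$2 - Z$1$2 * Z$1$2)
      + of_real (A$2$1 * B$1$2 + A$1$1 * B$2$2) * Z$1$1 + of_real (A$2$2 * B$1$1 + A$1$2 * B$2$1) * Z$2$2
      + of_real (A$2$2 * B$1$2 + A$1$2 * B$2$2)"
    by (simp add: Let_def denom_def numer_def mult_2_nth det_2 sym algebra_simps)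
  also have "\<dots> = autom Z (transpose A ** swap2 ** B, 1)"
    by (simp add: A B autom_def mult_2_nth swap2_def)
  finally show ?thesis .
qed

text \<open>The factor from the slash operator, the one in \<open>chi\<close> and the value of
  \<open>phi\<close> multiply to a single value of the linear form; the power of m is
  \<open>weight_pow\<close> of m and becomes the scaling in \<open>graph_plucker\<close>.\<close>

lemma slash_B_fun:
  assumes Z: "Z \<in> siegel_H2" and A: "det A = 1" and m: "m > 0"
  shows "slash k (B_fun k s) (upper_emb A) Z * of_nat m powr (- 2 * s - of_int k)
    = of_real (delta Z) powr s * (\<Sum>\<^sub>\<infinity>B\<in>SL2Z. eis_term k s Z (graph_plucker m A B))"
proof -
  define W where "W = act (upper_emb A) Z"
  define j where "j = jfac (upper_emb A) Z"
  have sp: "upper_emb A \<in> Sp2_real"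
    using A by (simp add: upper_emb_def cross_mat_Sp2)
  have t: "weight_pow k s (of_nat m) * (weight_pow k s j * (Phi k s (act (lower_emb B) W) * chi k s (lower_emb B) W))
      = eis_term k s Z (graph_plucker m A B)" if "B \<in> SL2Z" for B
  proof -
    have "graph_plucker m A B = real m *\<^sub>R (transpose A ** swap2 ** B, 1)"
      by (simp add: graph_plucker_def)
    hence "eis_term k s Z (graph_plucker m A B) = weight_pow k s (of_nat m * autom Z (transpose A ** swap2 ** B, 1))"
      by (simp only: eis_term_def autom_scaleR of_real_of_nat_eq)
    also have "autom Z (transpose A ** swap2 ** B, 1) = j * (phi (act (lower_emb B) W) * jfac (lower_emb B) W)"
      using phi_autom[OF Z A SL2Z_det[OF that]] by (simp add: W_def j_def mult_ac)
    finally show ?thesis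
      by (simp add: weight_pow_mult Phi_eq_weight_pow chi_eq_weight_pow)
  qed
  have "slash k (B_fun k s) (upper_emb A) Z = (j powi (- k) * of_real (delta W) powr s) *
      (\<Sum>\<^sub>\<infinity>B\<in>SL2Z. Phi k s (act (lower_emb B) W) * chi k s (lower_emb B) W)"
    by (simp add: slash_def B_fun_def W_def j_def)
  also have "j powi (- k) * of_real (delta W) powr s = of_real (delta Z) powr s * weight_pow k s j"
    unfolding j_def W_def by (rule slash_delta_powr[OF sp Z])
  finally have "slash k (B_fun k s) (upper_emb A) Z * of_nat m powr (- 2 * s - of_int k)
    = of_real (delta Z) powr s * (weight_pow k s (of_nat m) * (weight_pow k s j *
      (\<Sum>\<^sub>\<infinity>B\<in>SL2Z. Phi k s (act (lower_emb B) W) * chi k s (lower_emb B) W)))"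
    unfolding weight_pow_of_nat[OF m] by (simp only: mult_ac)
  also have "\<dots> = of_real (delta Z) powr s * (\<Sum>\<^sub>\<infinity>B\<in>SL2Z. weight_pow k s (of_nat m) * (weight_pow k s j *
      (Phi k s (act (lower_emb B) W) * chi k s (lower_emb B) W)))"
    by (simp only: infsum_cmult_right')
  also have "\<dots> = of_real (delta Z) powr s * (\<Sum>\<^sub>\<infinity>B\<in>SL2Z. eis_term k s Z (graph_plucker m A B))"
    by (simp only: t cong: infsum_cong)
  finally show ?thesis .
qed

section \<open>Absolute convergence over the cosets\<close>

definition tuple_plucker :: "int \<times> int \<times> int \<times> int \<times> int \<Rightarrow> (real^2^2) \<times> real" where
  "tuple_plucker = (\<lambda>(a,b,c,d,t). (imat a b c d, of_int t))"

lemma inj_tuple_plucker: "inj tuple_plucker"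
  by (auto simp: inj_def tuple_plucker_def vec_eq_iff forall_2)

lemma maxabs_le_norm: "maxabs q \<le> norm (tuple_plucker q)"
proof -
  obtain a b c d t where q: "q = (a,b,c,d,t)" by (cases q) auto
  have e: "\<bar>fst p $ i $ j\<bar> \<le> norm p" for p :: "(real^2^2) \<times> real" and i j
  proof -
    have "\<bar>fst p $ i $ j\<bar> \<le> norm (fst p $ i)"
      using Finite_Cartesian_Product.norm_nth_le[of "fst p $ i" j] by simp
    also have "\<dots> \<le> norm (fst p)" by (rule Finite_Cartesian_Product.norm_nth_le)
    also have "\<dots> \<le> norm p" using norm_fst_le[of "fst p" "snd p"] by simp
    finally show ?thesis .
  qed
  have f: "\<bar>snd p\<bar> \<le> norm p" for p :: "(real^2^2) \<times> real"
    using norm_snd_le[of "snd p" "fst p"] by simp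
  have "\<bar>real_of_int a\<bar> \<le> norm (tuple_plucker q)" using e[of "tuple_plucker q" 1 1] by (simp add: q tuple_plucker_def)
  moreover have "\<bar>real_of_int b\<bar> \<le> norm (tuple_plucker q)" using e[of "tuple_plucker q" 1 2] by (simp add: q tuple_plucker_def)
  moreover have "\<bar>real_of_int c\<bar> \<le> norm (tuple_plucker q)" using e[of "tuple_plucker q" 2 1] by (simp add: q tuple_plucker_def)
  moreover have "\<bar>real_of_int d\<bar> \<le> norm (tuple_plucker q)" using e[of "tuple_plucker q" 2 2] by (simp add: q tuple_plucker_def)
  moreover have "\<bar>real_of_int t\<bar> \<le> norm (tuple_plucker q)" using f[of "tuple_plucker q"] by (simp add: q tuple_plucker_def)
  moreover have "maxabs q = max (max \<bar>real_of_int a\<bar> \<bar>real_of_int c\<bar>)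
      (max (max \<bar>real_of_int b\<bar> \<bar>real_of_int d\<bar>) \<bar>real_of_int t\<bar>)"
    by (simp add: q maxabs_def)
  ultimately show ?thesis by (simp only: max.bounded_iff)
qed

text \<open>Only the zero vector is excluded, since a zero matrix component forces t = 0.\<close>

definition isotropic_ints :: "(int \<times> int \<times> int \<times> int \<times> int) set" where
  "isotropic_ints = {(a,b,c,d,t). a * d - b * c = - t\<^sup>2 \<and> (a,b,c,d) \<noteq> (0,0,0,0)}"

lemma isotropic_tuple_plucker: "q \<in> isotropic_ints \<Longrightarrow> isotropic (tuple_plucker q)"
  by (auto simp: isotropic_ints_def isotropic_def tuple_plucker_def det_imat simp del: of_int_diff of_int_mult)

lemma eis_term_summable:
  assumes Z: "Z \<in> siegel_H2" and conv: "2 * Re s + of_int k > 3"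
  shows "(\<lambda>p. cmod (eis_term k s Z p)) summable_on tuple_plucker ` isotropic_ints"
proof -
  define \<sigma> where "\<sigma> = 2 * Re s + of_int k"
  obtain c where c: "c > 0" "\<And>p. isotropic p \<Longrightarrow> c * norm p \<le> cmod (autom Z p)"
    using autom_lower_bound[OF Z] by blast
  have "(\<lambda>q. maxabs q powr (-\<sigma>)) summable_on isotropic_ints"
    unfolding isotropic_ints_def using conv by (intro summable_isotropic) (simp add: \<sigma>_def)
  hence "(\<lambda>q. c powr (-\<sigma>) * maxabs q powr (-\<sigma>)) summable_on isotropic_ints"
    by (rule summable_on_cmult_right)
  hence "(\<lambda>q. cmod (eis_term k s Z (tuple_plucker q))) summable_on isotropic_ints"
  proof (rule summable_on_comparison_test)
    fix q assume q: "q \<in> isotropic_ints"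
    obtain a b e d t where q': "q = (a,b,e,d,t)" by (cases q) auto
    have "a \<noteq> 0 \<or> b \<noteq> 0 \<or> e \<noteq> 0 \<or> d \<noteq> 0" using q by (auto simp: isotropic_ints_def q')
    hence pos: "maxabs q > 0"
      using maxabs_ge[where a = a and b = b and c = e and d = d and t = t] unfolding q' by linarith
    have le: "c * maxabs q \<le> cmod (autom Z (tuple_plucker q))"
      using c(2)[OF isotropic_tuple_plucker[OF q]] maxabs_le_norm[of q] c(1)
      by (meson mult_left_mono less_imp_le order_trans)
    have "c * maxabs q > 0" using pos c(1) by simp
    hence nz: "autom Z (tuple_plucker q) \<noteq> 0" using le by auto
    have "cmod (eis_term k s Z (tuple_plucker q)) = cmod (autom Z (tuple_plucker q)) powr (-\<sigma>)"
      unfolding eis_term_def norm_weight_pow[OF nz] \<sigma>_def ..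
    also have "\<dots> \<le> (c * maxabs q) powr (-\<sigma>)"
      using \<open>c * maxabs q > 0\<close> le conv by (intro powr_mono2') (simp_all add: \<sigma>_def)
    also have "\<dots> = c powr (-\<sigma>) * maxabs q powr (-\<sigma>)"
      using c(1) pos by (simp add: powr_mult)
    finally show "cmod (eis_term k s Z (tuple_plucker q)) \<le> c powr (-\<sigma>) * maxabs q powr (-\<sigma>)" .
  qed auto
  moreover have "inj_on tuple_plucker isotropic_ints"
    using inj_tuple_plucker by (rule inj_on_subset) auto
  ultimately show ?thesis by (simp add: summable_on_reindex o_def)
qed

definition siegel_cosets :: "(real^4^4) set set" where
  "siegel_cosets = left_quot Gamma20 Gamma2"

lemma siegel_cosets_rep:
  assumes "c \<in> siegel_cosets"
  shows "coset_rep c \<in> Gamma2" "right_coset Gamma20 (coset_rep c) = c"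
  using left_quot_rep[OF matrix_group_Gamma20 Gamma20_Gamma2] assms
  unfolding siegel_cosets_def by blast+

lemma plucker_in_tuple_plucker:
  assumes "g \<in> Gamma2"
  shows "plucker g \<in> tuple_plucker ` isotropic_ints"
proof -
  obtain a b c d t where p: "plucker g = (imat a b c d, of_int t)" "gcd (gcd a b) (gcd c d) = 1"
    "a * d - b * c = - t\<^sup>2"
    using plucker_Gamma2[OF assms] .
  have "(a,b,c,d) \<noteq> (0,0,0,0)" using p(2) by auto
  hence "(a,b,c,d,t) \<in> isotropic_ints" using p(3) by (simp add: isotropic_ints_def)
  moreover have "plucker g = tuple_plucker (a,b,c,d,t)" by (simp add: tuple_plucker_def p(1))
  ultimately show ?thesis by blast
qed

lemma siegel_cosets_summable:
  assumes Z: "Z \<in> siegel_H2" and conv: "2 * Re s + of_int k > 3"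
  shows "(\<lambda>c. eis_term k s Z (plucker (coset_rep c))) summable_on siegel_cosets"
proof -
  let ?h = "\<lambda>c. plucker (coset_rep c)"
  have "?h ` siegel_cosets \<subseteq> tuple_plucker ` isotropic_ints"
    using siegel_cosets_rep(1) plucker_in_tuple_plucker by blast
  hence "(\<lambda>p. cmod (eis_term k s Z p)) summable_on ?h ` siegel_cosets"
    using eis_term_summable[OF assms] summable_on_subset_banach by blast
  moreover have "inj_on ?h siegel_cosets"
  proof (rule inj_onI)
    fix c c' assume c: "c \<in> siegel_cosets" "c' \<in> siegel_cosets" and "?h c = ?h c'"
    hence "right_coset Gamma20 (coset_rep c) = right_coset Gamma20 (coset_rep c')"
      by (subst right_coset_Gamma20_eq_iff) (simp_all add: siegel_cosets_rep)
    thus "c = c'" using siegel_cosets_rep(2) c by simp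
  qed
  ultimately have "(\<lambda>c. norm (eis_term k s Z (plucker (coset_rep c)))) summable_on siegel_cosets"
    by (simp add: summable_on_reindex o_def)
  thus ?thesis by (rule Infinite_Sum.abs_summable_summable)
qed

lemma eis_term_coset_rep:
  assumes "even k"
  shows "eis_term k s Z (plucker (coset_rep (right_coset Gamma20 g))) = eis_term k s Z (plucker g)"
  using plucker_coset_rep[of g] eis_term_minus[OF assms] by metis

lemma Eis2_eq:
  assumes Z: "Z \<in> siegel_H2"
  shows "Eis2 k s Z = of_real (delta Z) powr s * (\<Sum>\<^sub>\<infinity>c\<in>siegel_cosets. eis_term k s Z (plucker (coset_rep c)))"
proof -
  have "jfac (coset_rep c) Z powi (- k) * complex_of_real (delta (act (coset_rep c) Z)) powr s
      = of_real (delta Z) powr s * eis_term k s Z (plucker (coset_rep c))" if "c \<in> siegel_cosets" for c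
  proof -
    have "coset_rep c \<in> Sp2_real" using siegel_cosets_rep(1)[OF that] by (simp add: Gamma2_def)
    thus ?thesis using slash_delta_powr weight_pow_jfac Z by simp
  qed
  hence "Eis2 k s Z = (\<Sum>\<^sub>\<infinity>c\<in>siegel_cosets. of_real (delta Z) powr s * eis_term k s Z (plucker (coset_rep c)))"
    unfolding Eis2_def Let_def siegel_cosets_def[symmetric] by (intro infsum_cong) simp
  thus ?thesis by (simp only: infsum_cmult_right')
qed

section \<open>The two types of cosets\<close>

lemma SL2Z_inf_bottom:
  assumes "h \<in> SL2Z_inf"
  obtains e where "e = 1 \<or> e = -1" "\<And>(A::real^2^2) j. (h ** A)$2$j = e * A$2$j"
proof -
  have h: "h$2$1 = 0" "det h = 1" "h$1$1 \<in> \<int>" "h$2$2 \<in> \<int>"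
    using assms by (simp_all add: SL2Z_inf_def SL2Z_def)
  then obtain a d where ad: "h$1$1 = of_int a" "h$2$2 = of_int d"
    by (auto elim!: Ints_cases)
  have "real_of_int (a * d) = of_int 1" using h(1,2) ad by (simp add: det_2)
  hence "a * d = 1" by (simp only: of_int_eq_iff)
  hence "d = 1 \<or> d = -1" by (auto simp: zmult_eq_1_iff)
  hence "h$2$2 = 1 \<or> h$2$2 = -1" using ad by auto
  moreover have "(h ** A)$2$j = h$2$2 * A$2$j" for A :: "real^2^2" and j by (simp add: mult_2_nth h)
  ultimately show ?thesis using that by blast
qed

text \<open>The lower left entry of A' A^(-1) is the determinant formed by the bottom rows of A' and
  A, so parallel bottom rows give the same coset.\<close>

lemma right_coset_SL2Z_inf_eqI:
  assumes "A \<in> SL2Z" "A' \<in> SL2Z" "A'$2$1 * A$2$2 = A'$2$2 * A$2$1"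
  shows "right_coset SL2Z_inf A = right_coset SL2Z_inf A'"
proof -
  define h where "h = A' ** adj2 A"
  have "h \<in> SL2Z" using assms by (simp add: h_def SL2Z_mult SL2Z_adj2)
  moreover have "h$2$1 = 0" using assms(3) by (simp add: h_def mult_2_nth adj2_def)
  ultimately have "h \<in> SL2Z_inf" by (simp add: SL2Z_inf_def)
  moreover have "A' = h ** A"
    using assms by (simp add: h_def adj2_left SL2Z_det flip: matrix_mul_assoc)
  ultimately show ?thesis using right_coset_mult[OF matrix_group_SL2Z_inf] by simp
qed

definition modular_cosets :: "(real^2^2) set set" where
  "modular_cosets = left_quot SL2Z_inf SL2Z"

lemma modular_cosets_rep:
  assumes "c \<in> modular_cosets"
  shows "coset_rep c \<in> SL2Z" "right_coset SL2Z_inf (coset_rep c) = c"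
  using left_quot_rep[OF matrix_group_SL2Z_inf SL2Z_inf_SL2Z] assms
  unfolding modular_cosets_def by blast+

definition split_cosets :: "(real^4^4) set set" where
  "split_cosets = {c \<in> siegel_cosets. snd (plucker (coset_rep c)) = 0}"

definition split_coset :: "(real^2^2) set \<times> (real^2^2) set \<Rightarrow> (real^4^4) set" where
  "split_coset = (\<lambda>(c, d). right_coset Gamma20 (cross_mat (coset_rep c) (coset_rep d)))"

text \<open>A nonzero rank one tensor determines the lines spanned by its factors; here this
  recovers the bottom row of each SL2 component from the Pluecker matrix.\<close>

lemma parallel_of_tensor_eq:
  fixes x y x' y' :: real
  assumes "x * u = e * (x' * u')" "x * v = e * (x' * v')" "y * u = e * (y' * u')" "y * v = e * (y' * v')"
    and "e \<noteq> 0" "u' \<noteq> 0 \<or> v' \<noteq> 0"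
  shows "x' * y = y' * x"
proof -
  have "e * u' * (x' * y - y' * x) = 0" "e * v' * (x' * y - y' * x) = 0"
    using assms(1-4) by algebra+
  thus ?thesis using assms(5,6) by auto
qed

lemma SL2Z_bottom_nonzero: "A \<in> SL2Z \<Longrightarrow> A$2$1 \<noteq> 0 \<or> A$2$2 \<noteq> 0"
  using SL2Z_det[of A] by (auto simp: det_2)

lemma inj_split_coset: "inj_on split_coset (modular_cosets \<times> modular_cosets)"
proof (rule inj_onI)
  fix x x' assume x: "x \<in> modular_cosets \<times> modular_cosets" "x' \<in> modular_cosets \<times> modular_cosets"
    and eq: "split_coset x = split_coset x'"
  obtain c d c' d' where cd: "x = (c, d)" "x' = (c', d')" by (cases x, cases x') auto
  define A B A' B' where AB: "A = coset_rep c" "B = coset_rep d" "A' = coset_rep c'" "B' = coset_rep d'"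
  have S: "A \<in> SL2Z" "B \<in> SL2Z" "A' \<in> SL2Z" "B' \<in> SL2Z"
    using x modular_cosets_rep(1) by (simp_all add: cd AB)
  have "right_coset Gamma20 (cross_mat A' B') = right_coset Gamma20 (cross_mat A B)"
    using eq by (simp add: split_coset_def cd AB)
  hence "plucker (cross_mat A B) = plucker (cross_mat A' B') \<or> plucker (cross_mat A B) = - plucker (cross_mat A' B')"
    using right_coset_Gamma20_eq_iff cross_mat_Gamma2 S by simp
  then obtain e :: real where e: "e \<noteq> 0" "plucker (cross_mat A B) = e *\<^sub>R plucker (cross_mat A' B')"
    by (metis scaleR_minus1_left scaleR_one neg_equal_0_iff_equal one_neq_zero)
  have t: "A$2$1 * B$2$1 = e * (A'$2$1 * B'$2$1)" "A$2$1 * B$2$2 = e * (A'$2$1 * B'$2$2)"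
    "A$2$2 * B$2$1 = e * (A'$2$2 * B'$2$1)" "A$2$2 * B$2$2 = e * (A'$2$2 * B'$2$2)"
    using e(2) by (simp_all add: plucker_cross_mat vec_eq_iff forall_2)
  have "A'$2$1 * A$2$2 = A'$2$2 * A$2$1"
    by (rule parallel_of_tensor_eq[OF t(1,2,3,4) e(1) SL2Z_bottom_nonzero[OF S(4)]])
  hence "right_coset SL2Z_inf A = right_coset SL2Z_inf A'"
    using S by (intro right_coset_SL2Z_inf_eqI)
  moreover have "B'$2$1 * B$2$2 = B'$2$2 * B$2$1"
    by (rule parallel_of_tensor_eq[OF _ _ _ _ e(1) SL2Z_bottom_nonzero[OF S(3)]])
       (use t in \<open>simp_all add: mult.commute\<close>)
  hence "right_coset SL2Z_inf B = right_coset SL2Z_inf B'"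
    using S by (intro right_coset_SL2Z_inf_eqI)
  ultimately show "x = x'"
    using x modular_cosets_rep(2) by (simp add: cd AB)
qed

lemma cross_mat_SL2Z_inf_plucker:
  assumes "h \<in> SL2Z_inf" "h' \<in> SL2Z_inf"
  shows "plucker (cross_mat (h ** A) (h' ** B)) = plucker (cross_mat A B) \<or>
    plucker (cross_mat (h ** A) (h' ** B)) = - plucker (cross_mat A B)"
proof -
  obtain e where e: "e = 1 \<or> e = -1" "\<And>(A::real^2^2) j. (h ** A)$2$j = e * A$2$j"
    using SL2Z_inf_bottom[OF assms(1)] by blast
  obtain e' where e': "e' = 1 \<or> e' = -1" "\<And>(A::real^2^2) j. (h' ** A)$2$j = e' * A$2$j"
    using SL2Z_inf_bottom[OF assms(2)] by blast
  have "plucker (cross_mat (h ** A) (h' ** B)) = (e * e') *\<^sub>R plucker (cross_mat A B)"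
    by (simp add: plucker_cross_mat e(2) e'(2) vec_eq_iff forall_2)
  thus ?thesis using e(1) e'(1) by auto
qed

lemma split_coset_image: "split_coset ` (modular_cosets \<times> modular_cosets) = split_cosets"
proof
  show "split_coset ` (modular_cosets \<times> modular_cosets) \<subseteq> split_cosets"
  proof
    fix z assume "z \<in> split_coset ` (modular_cosets \<times> modular_cosets)"
    then obtain c d where cd: "c \<in> modular_cosets" "d \<in> modular_cosets" "z = split_coset (c, d)" by blast
    define g where "g = cross_mat (coset_rep c) (coset_rep d)"
    have "g \<in> Gamma2" using cd modular_cosets_rep(1) by (simp add: g_def cross_mat_Gamma2)
    moreover have z: "z = right_coset Gamma20 g" by (simp add: cd g_def split_coset_def)
    ultimately have "z \<in> siegel_cosets" by (simp add: siegel_cosets_def right_coset_in_left_quot)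
    moreover have "snd (plucker g) = 0" by (simp add: g_def plucker_cross_mat)
    hence "snd (plucker (coset_rep z)) = 0" using plucker_coset_rep[of g] by (auto simp: z)
    ultimately show "z \<in> split_cosets" by (simp add: split_cosets_def)
  qed
  show "split_cosets \<subseteq> split_coset ` (modular_cosets \<times> modular_cosets)"
  proof
    fix z assume z: "z \<in> split_cosets"
    define g where "g = coset_rep z"
    have g: "g \<in> Gamma2" "right_coset Gamma20 g = z" "snd (plucker g) = 0"
      using z siegel_cosets_rep by (simp_all add: split_cosets_def g_def)
    obtain a b c d t where p: "plucker g = (imat a b c d, of_int t)" "gcd (gcd a b) (gcd c d) = 1"
      "a * d - b * c = - t\<^sup>2"
      using plucker_Gamma2[OF g(1)] .
    have "t = 0" using p(1) g(3) by simp
    then obtain U V where UV: "U \<in> SL2Z" "V \<in> SL2Z" "imat a b c d = U ** imat 0 0 0 1 ** V"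
      using smith_form[OF p(2)] p(3) by auto
    define A where "A = transpose U"
    have A: "A \<in> SL2Z" using UV by (simp add: A_def SL2Z_transpose)
    \<comment> \<open>\<open>imat 0 0 0 1\<close> selects the second column of U and the second row
      of V, that is, the bottom rows of A and V, and forms their tensor product.\<close>
    have "plucker (cross_mat A V) = (U ** imat 0 0 0 1 ** V, 0)"
      by (simp add: plucker_cross_mat A_def vec_eq_iff forall_2 mult_2_nth)
    hence plA: "plucker (cross_mat A V) = plucker g" using p(1) UV(3) \<open>t = 0\<close> by simp
    define x where "x = right_coset SL2Z_inf A"
    define y where "y = right_coset SL2Z_inf V"
    have xy: "x \<in> modular_cosets" "y \<in> modular_cosets"
      using A UV by (simp_all add: x_def y_def modular_cosets_def right_coset_in_left_quot)
    \<comment> \<open>The chosen representatives differ from A and V by upper triangular factors,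
      which affect the Pluecker vector only by a sign.\<close>
    obtain h where h: "h \<in> SL2Z_inf" "coset_rep x = h ** A"
      unfolding x_def using coset_rep_right_coset[OF matrix_group_SL2Z_inf] by blast
    obtain h' where h': "h' \<in> SL2Z_inf" "coset_rep y = h' ** V"
      unfolding y_def using coset_rep_right_coset[OF matrix_group_SL2Z_inf] by blast
    have "plucker (cross_mat (coset_rep x) (coset_rep y)) = plucker g \<or>
        plucker (cross_mat (coset_rep x) (coset_rep y)) = - plucker g"
      using cross_mat_SL2Z_inf_plucker[OF h(1) h'(1), of A V] by (simp only: h(2) h'(2) plA)
    moreover have "cross_mat (coset_rep x) (coset_rep y) \<in> Gamma2"
      using xy modular_cosets_rep(1) by (intro cross_mat_Gamma2)
    ultimately have "right_coset Gamma20 g = split_coset (x, y)"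
      using right_coset_Gamma20_eq_iff[OF g(1)] by (simp add: split_coset_def)
    thus "z \<in> split_coset ` (modular_cosets \<times> modular_cosets)" using xy g(2) by blast
  qed
qed

lemma A_fun_eq:
  assumes "even k" and Z: "Z \<in> siegel_H2"
  shows "A_fun k s Z = of_real (delta Z) powr s * (\<Sum>\<^sub>\<infinity>c\<in>split_cosets. eis_term k s Z (plucker (coset_rep c)))"
proof -
  have "bij_betw split_coset (modular_cosets \<times> modular_cosets) split_cosets"
    using inj_split_coset split_coset_image by (simp add: bij_betw_def)
  hence "(\<Sum>\<^sub>\<infinity>c\<in>split_cosets. eis_term k s Z (plucker (coset_rep c)))
    = (\<Sum>\<^sub>\<infinity>x\<in>modular_cosets \<times> modular_cosets. eis_term k s Z (plucker (coset_rep (split_coset x))))"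
    by (rule infsum_reindex_bij_betw[symmetric])
  also have "\<dots> = (\<Sum>\<^sub>\<infinity>(c, d)\<in>modular_cosets \<times> modular_cosets.
      chi k s (upper_emb (coset_rep c) ** lower_emb (coset_rep d)) Z)"
  proof (rule infsum_cong)
    fix x assume "x \<in> modular_cosets \<times> modular_cosets"
    then obtain c d where x: "x = (c, d)" "c \<in> modular_cosets" "d \<in> modular_cosets" by blast
    have "cross_mat (coset_rep c) (coset_rep d) \<in> Sp2_real"
      using x modular_cosets_rep(1) SL2Z_det by (intro cross_mat_Sp2) auto
    thus "eis_term k s Z (plucker (coset_rep (split_coset x))) = (case x of (c, d) \<Rightarrow>
        chi k s (upper_emb (coset_rep c) ** lower_emb (coset_rep d)) Z)"
      using weight_pow_jfac[OF _ Z] eis_term_coset_rep[OF assms(1)]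
      by (simp add: x split_coset_def upper_lower_emb chi_eq_weight_pow)
  qed
  finally show ?thesis by (simp add: A_fun_def modular_cosets_def)
qed

section \<open>Graphs of anti-isometries: nonzero scalar component\<close>

definition hecke_matrix :: "nat \<Rightarrow> real^2^2" where
  "hecke_matrix m = mat2 (real m) 0 0 (inverse (real m))"

definition hecke_cosets :: "nat \<Rightarrow> (real^2^2) set set" where
  "hecke_cosets m = left_quot SL2Z (double_coset (hecke_matrix m))"

lemma double_coset_SL2Z: "h \<in> SL2Z \<Longrightarrow> g \<in> double_coset g0 \<Longrightarrow> h ** g \<in> double_coset g0"
  unfolding double_coset_def by (auto simp: matrix_mul_assoc) (metis SL2Z_mult matrix_mul_assoc)

lemma hecke_cosets_rep:
  assumes "c \<in> hecke_cosets m"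
  shows "coset_rep c \<in> double_coset (hecke_matrix m)" "right_coset SL2Z (coset_rep c) = c"
  using left_quot_rep[OF matrix_group_SL2Z double_coset_SL2Z] assms
  unfolding hecke_cosets_def by blast+

lemma double_coset_det:
  assumes "m > 0" "A \<in> double_coset (hecke_matrix m)"
  shows "det A = 1"
proof -
  have "det (hecke_matrix m) = 1" using assms(1) by (simp add: hecke_matrix_def det_2)
  thus ?thesis using assms(2) by (auto simp: double_coset_def det_mul SL2Z_det)
qed

lemma hecke_matrix_swap2: "m > 0 \<Longrightarrow> real m *\<^sub>R (hecke_matrix m ** swap2) = imat 0 ((int m)\<^sup>2) 1 0"
  by (simp add: hecke_matrix_def swap2_def vec_eq_iff forall_2 mult_2_nth power2_eq_square)

lemma transpose_hecke_matrix: "transpose (hecke_matrix m) = hecke_matrix m"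
  by (simp add: hecke_matrix_def vec_eq_iff forall_2)

lemma scaleR_matrix_mult_middle:
  fixes A X B :: "real^2^2"
  shows "r *\<^sub>R (A ** X ** B) = A ** (r *\<^sub>R X) ** B"
  by (simp add: vec_eq_iff mult_2_nth algebra_simps)

text \<open>For A = a diag(m, 1/m) b, the factor a^T is carried across \<open>swap2\<close> by
  conjugation and absorbed into the right-hand unimodular matrix. What remains is the normal form
  between elements of \<open>SL2Z\<close>.\<close>

lemma graph_plucker_realised:
  assumes m: "m > 0" and A: "A \<in> double_coset (hecke_matrix m)" and B: "B \<in> SL2Z"
  shows "\<exists>g\<in>Gamma2. plucker g = graph_plucker m A B"
proof -
  obtain a b where ab: "a \<in> SL2Z" "b \<in> SL2Z" "A = a ** hecke_matrix m ** b"
    using A unfolding double_coset_def by blast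
  let ?V = "(swap2 ** transpose a ** swap2) ** B"
  have "transpose A ** swap2 ** B = transpose b ** (hecke_matrix m ** (swap2 ** swap2)) ** transpose a ** swap2 ** B"
    unfolding ab(3) matrix_transpose_mul transpose_hecke_matrix swap2_swap2 by (simp add: matrix_mul_assoc)
  also have "\<dots> = transpose b ** (hecke_matrix m ** swap2) ** ?V"
    by (simp only: matrix_mul_assoc)
  finally have "real m *\<^sub>R (transpose A ** swap2 ** B)
      = transpose b ** (real m *\<^sub>R (hecke_matrix m ** swap2)) ** ?V"
    by (simp only: scaleR_matrix_mult_middle)
  hence "graph_plucker m A B = (transpose b ** imat 0 ((int m)\<^sup>2) 1 0 ** ?V, of_int (int m))"
    by (simp only: graph_plucker_def hecke_matrix_swap2[OF m] of_int_of_nat_eq)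
  moreover have "transpose b \<in> SL2Z" "?V \<in> SL2Z"
    using ab B by (simp_all add: SL2Z_transpose SL2Z_conj_swap2 SL2Z_mult)
  ultimately show ?thesis using plucker_surj by metis
qed

text \<open>A change of representative of the Hecke coset is compensated by a translation of B
  within \<open>SL2Z\<close>. Hence one representative per coset, together with all B,
  suffices.\<close>

lemma graph_plucker_SL2Z_mult:
  "graph_plucker m (h ** A) B = graph_plucker m A (swap2 ** transpose h ** swap2 ** B)"
proof -
  have "transpose A ** swap2 ** (swap2 ** transpose h ** swap2 ** B)
      = transpose A ** (swap2 ** swap2) ** transpose h ** swap2 ** B"
    by (simp only: matrix_mul_assoc)
  also have "\<dots> = transpose (h ** A) ** swap2 ** B"
    by (simp add: swap2_swap2 matrix_transpose_mul matrix_mul_assoc)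
  finally show ?thesis by (simp add: graph_plucker_def)
qed

definition graph_cosets :: "(real^4^4) set set" where
  "graph_cosets = {c \<in> siegel_cosets. snd (plucker (coset_rep c)) \<noteq> 0}"

definition graph_index :: "(nat \<times> (real^2^2) set \<times> (real^2^2)) set" where
  "graph_index = (SIGMA m:{1..}. hecke_cosets m \<times> SL2Z)"

text \<open>Any choice serves, because the Pluecker vector already determines the coset.\<close>

definition graph_elem :: "nat \<times> (real^2^2) set \<times> (real^2^2) \<Rightarrow> real^4^4" where
  "graph_elem = (\<lambda>(m, c, B). SOME g. g \<in> Gamma2 \<and> plucker g = graph_plucker m (coset_rep c) B)"

lemma graph_elem:
  assumes "(m, c, B) \<in> graph_index"
  shows "graph_elem (m, c, B) \<in> Gamma2" "plucker (graph_elem (m, c, B)) = graph_plucker m (coset_rep c) B"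
proof -
  have "m > 0" "c \<in> hecke_cosets m" "B \<in> SL2Z" using assms by (auto simp: graph_index_def)
  hence "\<exists>g. g \<in> Gamma2 \<and> plucker g = graph_plucker m (coset_rep c) B"
    using graph_plucker_realised hecke_cosets_rep(1) by blast
  hence "graph_elem (m, c, B) \<in> Gamma2 \<and> plucker (graph_elem (m, c, B)) = graph_plucker m (coset_rep c) B"
    unfolding graph_elem_def prod.case by (rule someI_ex)
  thus "graph_elem (m, c, B) \<in> Gamma2" "plucker (graph_elem (m, c, B)) = graph_plucker m (coset_rep c) B"
    by blast+
qed

text \<open>Solving the transposed equation for A' gives A' = (w C w) A with w =
  \<open>swap2\<close> and C unimodular. Once A = A', invertibility of A and w cancels them.\<close>

lemma graph_matrix_eqD:
  assumes A: "det A = 1" "det A' = 1" and B: "B \<in> SL2Z" "B' \<in> SL2Z"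
    and eq: "transpose A ** swap2 ** B = transpose A' ** swap2 ** B'"
  shows "right_coset SL2Z A = right_coset SL2Z A'" and "A = A' \<Longrightarrow> B = B'"
proof -
  have "transpose B ** swap2 ** A = transpose (transpose A ** swap2 ** B)"
    by (simp add: matrix_transpose_mul transpose_swap2 matrix_mul_assoc)
  also have "\<dots> = transpose B' ** swap2 ** A'"
    unfolding eq by (simp add: matrix_transpose_mul transpose_swap2 matrix_mul_assoc)
  finally have e: "transpose B ** swap2 ** A = transpose B' ** swap2 ** A'" .
  have B': "transpose B' \<in> SL2Z" using B by (simp add: SL2Z_transpose)
  define C where "C = adj2 (transpose B') ** transpose B"
  have C: "C \<in> SL2Z" using B B' by (simp add: C_def SL2Z_mult SL2Z_adj2 SL2Z_transpose)
  have "swap2 ** C ** swap2 ** A = swap2 ** adj2 (transpose B') ** (transpose B ** swap2 ** A)"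
    by (simp only: C_def matrix_mul_assoc)
  also have "\<dots> = swap2 ** (adj2 (transpose B') ** transpose B') ** swap2 ** A'"
    unfolding e by (simp only: matrix_mul_assoc)
  also have "\<dots> = A'"
    by (simp add: adj2_left SL2Z_det[OF B(2)] swap2_swap2)
  finally have "right_coset SL2Z A' = right_coset SL2Z ((swap2 ** C ** swap2) ** A)"
    by (simp only: matrix_mul_assoc)
  thus "right_coset SL2Z A = right_coset SL2Z A'"
    using right_coset_mult[OF matrix_group_SL2Z SL2Z_conj_swap2[OF C]] by simp
  show "B = B'" if "A = A'"
  proof -
    have eq': "transpose A ** swap2 ** B = transpose A ** swap2 ** B'"
      using eq that by simp
    have "swap2 ** (adj2 (transpose A) ** transpose A) ** swap2 ** B
        = swap2 ** adj2 (transpose A) ** (transpose A ** swap2 ** B)"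
      by (simp only: matrix_mul_assoc)
    also have "\<dots> = swap2 ** (adj2 (transpose A) ** transpose A) ** swap2 ** B'"
      unfolding eq' by (simp only: matrix_mul_assoc)
    finally show ?thesis using A(1) by (simp add: adj2_left det_transpose swap2_swap2)
  qed
qed

lemma inj_graph_elem: "inj_on (\<lambda>x. right_coset Gamma20 (graph_elem x)) graph_index"
proof (rule inj_onI)
  fix x x' assume x: "x \<in> graph_index" "x' \<in> graph_index"
    and eq: "right_coset Gamma20 (graph_elem x) = right_coset Gamma20 (graph_elem x')"
  obtain m c B m' c' B' where xs: "x = (m, c, B)" "x' = (m', c', B')" by (cases x, cases x') auto
  have m: "m > 0" "m' > 0" and c: "c \<in> hecke_cosets m" "c' \<in> hecke_cosets m'" and B: "B \<in> SL2Z" "B' \<in> SL2Z"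
    using x by (auto simp: graph_index_def xs)
  have "graph_plucker m' (coset_rep c') B' = graph_plucker m (coset_rep c) B \<or>
      graph_plucker m' (coset_rep c') B' = - graph_plucker m (coset_rep c) B"
    using eq right_coset_Gamma20_eq_iff graph_elem x by (simp add: xs)
  \<comment> \<open>The scalar components m and m' are positive, which rules out the minus
    sign.\<close>
  moreover have "real m' \<noteq> - real m" using m by linarith
  ultimately have "graph_plucker m' (coset_rep c') B' = graph_plucker m (coset_rep c) B"
    by (auto simp: graph_plucker_def)
  hence mm: "m' = m" and N: "transpose (coset_rep c) ** swap2 ** B = transpose (coset_rep c') ** swap2 ** B'"
    using m by (auto simp: graph_plucker_def)
  have det: "det (coset_rep c) = 1" "det (coset_rep c') = 1"
    using double_coset_det hecke_cosets_rep(1) m c by blast+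
  have "c = c'"
    using graph_matrix_eqD(1)[OF det B N] hecke_cosets_rep(2) c by simp
  moreover from this have "B = B'" using graph_matrix_eqD(2)[OF det B N] by simp
  ultimately show "x = x'" by (simp add: xs mm)
qed

lemma graph_elem_image: "(\<lambda>x. right_coset Gamma20 (graph_elem x)) ` graph_index = graph_cosets"
proof
  show "(\<lambda>x. right_coset Gamma20 (graph_elem x)) ` graph_index \<subseteq> graph_cosets"
  proof
    fix z assume "z \<in> (\<lambda>x. right_coset Gamma20 (graph_elem x)) ` graph_index"
    then obtain m c B where x: "(m, c, B) \<in> graph_index" "z = right_coset Gamma20 (graph_elem (m, c, B))"
      by force
    have "z \<in> siegel_cosets"
      using graph_elem(1)[OF x(1)] by (simp add: x(2) siegel_cosets_def right_coset_in_left_quot)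
    moreover have "snd (plucker (graph_elem (m, c, B))) \<noteq> 0"
      using x(1) by (auto simp: graph_elem(2)[OF x(1)] graph_plucker_def graph_index_def)
    hence "snd (plucker (coset_rep z)) \<noteq> 0"
      using plucker_coset_rep[of "graph_elem (m, c, B)"] unfolding x(2) by auto
    ultimately show "z \<in> graph_cosets" by (simp add: graph_cosets_def)
  qed
  show "graph_cosets \<subseteq> (\<lambda>x. right_coset Gamma20 (graph_elem x)) ` graph_index"
  proof
    fix z assume z: "z \<in> graph_cosets"
    define g where "g = coset_rep z"
    have g: "g \<in> Gamma2" "right_coset Gamma20 g = z" "snd (plucker g) \<noteq> 0"
      using z siegel_cosets_rep by (simp_all add: graph_cosets_def g_def)
    obtain a b c d t where p: "plucker g = (imat a b c d, of_int t)" "gcd (gcd a b) (gcd c d) = 1"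
      "a * d - b * c = - t\<^sup>2"
      using plucker_Gamma2[OF g(1)] .
    \<comment> \<open>The Pluecker vector is multiplied by the sign of t to make its scalar
      component a positive m; the coset does not see this sign.\<close>
    define e where "e = sgn t"
    define m where "m = nat \<bar>t\<bar>"
    have t0: "t \<noteq> 0" using p(1) g(3) by simp
    hence e: "e = 1 \<or> e = -1" and m: "m > 0" and et: "e * t = int m"
      by (auto simp: e_def m_def sgn_if)
    have gcd: "gcd (gcd (e * a) (e * b)) (gcd (e * c) (e * d)) = 1"
      using e p(2) by auto
    have det: "(e * a) * (e * d) - (e * b) * (e * c) = - (int m)\<^sup>2"
      using e p(3) unfolding et[symmetric] by auto
    obtain U V where UV: "U \<in> SL2Z" "V \<in> SL2Z"
      "imat (e * a) (e * b) (e * c) (e * d) = U ** imat 0 ((int m)\<^sup>2) 1 0 ** V"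
      using smith_form_minus_square[OF gcd det] .
    define A where "A = mat 1 ** hecke_matrix m ** transpose U"
    have A: "A \<in> double_coset (hecke_matrix m)"
      unfolding A_def double_coset_def using SL2Z_one SL2Z_transpose[OF UV(1)] by blast
    have "transpose A ** swap2 ** V = U ** (hecke_matrix m ** swap2) ** V"
      by (simp add: A_def matrix_transpose_mul transpose_hecke_matrix matrix_mul_assoc)
    hence "graph_plucker m A V = (U ** (real m *\<^sub>R (hecke_matrix m ** swap2)) ** V, real m)"
      by (simp only: graph_plucker_def scaleR_matrix_mult_middle)
    also have "\<dots> = of_int e *\<^sub>R plucker g"
      unfolding hecke_matrix_swap2[OF m] UV(3)[symmetric] p(1)
      using et by (simp add: vec_eq_iff forall_2 flip: of_int_mult)
    finally have gp: "graph_plucker m A V = of_int e *\<^sub>R plucker g" .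
    define y where "y = right_coset SL2Z A"
    obtain h where h: "h \<in> SL2Z" "coset_rep y = h ** A"
      unfolding y_def using coset_rep_right_coset[OF matrix_group_SL2Z] by blast
    \<comment> \<open>The coset representative is \<open>h ** A\<close> instead of A; this B undoes
      the effect of h described by \<open>graph_plucker_SL2Z_mult\<close>.\<close>
    define B where "B = swap2 ** adj2 (transpose h) ** swap2 ** V"
    have hT: "transpose h \<in> SL2Z" using h by (simp add: SL2Z_transpose)
    have B: "B \<in> SL2Z" unfolding B_def
      using hT UV(2) by (intro SL2Z_mult SL2Z_conj_swap2 SL2Z_adj2)
    have "swap2 ** transpose h ** swap2 ** B
        = swap2 ** (transpose h ** ((swap2 ** swap2) ** adj2 (transpose h))) ** swap2 ** V"
      unfolding B_def by (simp only: matrix_mul_assoc)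
    also have "\<dots> = V"
      by (simp add: swap2_swap2 adj2_right SL2Z_det[OF h(1)])
    finally have "graph_plucker m (coset_rep y) B = of_int e *\<^sub>R plucker g"
      unfolding h(2) graph_plucker_SL2Z_mult using gp by simp
    moreover have idx: "(m, y, B) \<in> graph_index"
      using m A B by (simp add: graph_index_def hecke_cosets_def y_def right_coset_in_left_quot)
    ultimately have "plucker (graph_elem (m, y, B)) = plucker g \<or> plucker (graph_elem (m, y, B)) = - plucker g"
      using graph_elem(2)[OF idx] e by auto
    hence "right_coset Gamma20 (graph_elem (m, y, B)) = z"
      using right_coset_Gamma20_eq_iff[OF g(1) graph_elem(1)[OF idx]] g(2) by simp
    thus "z \<in> (\<lambda>x. right_coset Gamma20 (graph_elem x)) ` graph_index" using idx by blast
  qed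
qed

lemma bij_graph_elem: "bij_betw (\<lambda>x. right_coset Gamma20 (graph_elem x)) graph_index graph_cosets"
  using inj_graph_elem graph_elem_image by (simp add: bij_betw_def)

lemma eis_term_graph_elem:
  assumes "even k" "(m, c, B) \<in> graph_index"
  shows "eis_term k s Z (plucker (coset_rep (right_coset Gamma20 (graph_elem (m, c, B)))))
    = eis_term k s Z (graph_plucker m (coset_rep c) B)"
  using eis_term_coset_rep[OF assms(1)] graph_elem(2)[OF assms(2)] by simp

section \<open>Assembly of the two types of cosets\<close>

theorem theorem3p3:
  fixes k :: int and s :: complex and Z :: "complex^2^2"
  assumes "even k" and "Z \<in> siegel_H2" and "2 * Re s + of_int k > 3"
  defines "T \<equiv> (\<lambda>m::nat. hecke k (B_fun k s) (mat2 (real m) 0 0 (inverse (real m))) Z *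
                    of_nat m powr (-2 * s - of_int k))"
  shows "summable (\<lambda>n. T (Suc n)) \<and>
    Eis2 k s Z = A_fun k s Z + (\<Sum>n. T (Suc n))"
proof -
  note Z = assms(2)
  let ?d = "complex_of_real (delta Z) powr s"
  let ?F = "\<lambda>c. eis_term k s Z (plucker (coset_rep c))"
  define G where "G = (\<lambda>m c B. eis_term k s Z (graph_plucker m (coset_rep c) B))"
  have sum: "?F summable_on siegel_cosets" by (rule siegel_cosets_summable[OF Z assms(3)])
  have un: "siegel_cosets = split_cosets \<union> graph_cosets" "split_cosets \<inter> graph_cosets = {}"
    by (auto simp: split_cosets_def graph_cosets_def)
  have sum_split: "?F summable_on split_cosets" and sum_graph: "?F summable_on graph_cosets"
    using sum by (rule summable_on_subset_banach; simp add: un)+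
  have G: "?F (right_coset Gamma20 (graph_elem x)) = (case x of (m, c, B) \<Rightarrow> G m c B)"
    if "x \<in> graph_index" for x
    using that eis_term_graph_elem[OF assms(1)] by (cases x) (simp add: G_def)
  have "(\<lambda>x. ?F (right_coset Gamma20 (graph_elem x))) summable_on graph_index"
    by (rule iffD2[OF summable_on_reindex_bij_betw[OF bij_graph_elem, of ?F] sum_graph])
  hence "(\<lambda>(m, c, B). G m c B) summable_on graph_index"
    using G by (subst summable_on_cong[of graph_index]) auto
  hence sG: "(\<lambda>(m, y). case y of (c, B) \<Rightarrow> G m c B) summable_on (SIGMA m:{1..}. hecke_cosets m \<times> SL2Z)"
    by (simp add: graph_index_def)
  define h where "h = (\<lambda>m. \<Sum>\<^sub>\<infinity>(c, B)\<in>hecke_cosets m \<times> SL2Z. G m c B)"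
  have "(\<Sum>\<^sub>\<infinity>c\<in>graph_cosets. ?F c) = (\<Sum>\<^sub>\<infinity>x\<in>graph_index. ?F (right_coset Gamma20 (graph_elem x)))"
    by (rule infsum_reindex_bij_betw[OF bij_graph_elem, symmetric])
  also have "\<dots> = (\<Sum>\<^sub>\<infinity>(m, c, B)\<in>graph_index. G m c B)"
    by (rule infsum_cong) (rule G)
  also have "\<dots> = (\<Sum>\<^sub>\<infinity>m\<in>{1..}. h m)"
    unfolding h_def graph_index_def by (rule infsum_Sigma'_banach[OF sG, symmetric])
  finally have graph: "(\<Sum>\<^sub>\<infinity>c\<in>graph_cosets. ?F c) = (\<Sum>\<^sub>\<infinity>m\<in>{1..}. h m)" .
  have sh: "h summable_on {1..}"
    unfolding h_def using summable_on_Sigma_banach[OF sG] by simp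
  \<comment> \<open>The section at a fixed m of the summable family is summable, so its sum equals
    the iterated sum over Hecke cosets and \<open>SL2Z\<close>, which is the Hecke translate up to
    the common factor.\<close>
  have T: "T m = ?d * h m" if m: "m > 0" for m
  proof -
    have "(\<lambda>y. case (m, y) of (m, y) \<Rightarrow> case y of (c, B) \<Rightarrow> G m c B) summable_on hecke_cosets m \<times> SL2Z"
      using summable_on_SigmaD1[OF sG] m by simp
    hence sm: "(\<lambda>(c, B). G m c B) summable_on (SIGMA c:hecke_cosets m. SL2Z)" by simp
    have "T m = (\<Sum>\<^sub>\<infinity>c\<in>hecke_cosets m. slash k (B_fun k s) (upper_emb (coset_rep c)) Z *
        of_nat m powr (- 2 * s - of_int k))"
      unfolding T_def hecke_def hecke_cosets_def hecke_matrix_def by (rule infsum_cmult_left'[symmetric])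
    also have "\<dots> = (\<Sum>\<^sub>\<infinity>c\<in>hecke_cosets m. ?d * (\<Sum>\<^sub>\<infinity>B\<in>SL2Z. G m c B))"
      unfolding G_def using double_coset_det[OF m] hecke_cosets_rep(1)
      by (intro infsum_cong slash_B_fun[OF Z _ m]) blast
    also have "\<dots> = ?d * (\<Sum>\<^sub>\<infinity>c\<in>hecke_cosets m. \<Sum>\<^sub>\<infinity>B\<in>SL2Z. G m c B)"
      by (rule infsum_cmult_right')
    also have "(\<Sum>\<^sub>\<infinity>c\<in>hecke_cosets m. \<Sum>\<^sub>\<infinity>B\<in>SL2Z. G m c B) = h m"
      unfolding h_def by (rule infsum_Sigma'_banach[OF sm])
    finally show ?thesis .
  qed
  \<comment> \<open>The unordered sum over m >= 1 becomes a series indexed from 0, whence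
    \<open>Suc n\<close>.\<close>
  have "bij_betw Suc UNIV {1..}"
    by (rule bij_betwI[where g = "\<lambda>n. n - 1"]) auto
  moreover have "(h has_sum (\<Sum>\<^sub>\<infinity>m\<in>{1..}. h m)) {1..}" using sh by (rule has_sum_infsum)
  ultimately have "((\<lambda>n. h (Suc n)) has_sum (\<Sum>\<^sub>\<infinity>m\<in>{1..}. h m)) UNIV"
    by (simp add: has_sum_reindex_bij_betw)
  hence "(\<lambda>n. h (Suc n)) sums (\<Sum>\<^sub>\<infinity>m\<in>{1..}. h m)" by (rule has_sum_imp_sums)
  hence "(\<lambda>n. ?d * h (Suc n)) sums (?d * (\<Sum>\<^sub>\<infinity>m\<in>{1..}. h m))" by (rule sums_mult)
  hence sums: "(\<lambda>n. T (Suc n)) sums (?d * (\<Sum>\<^sub>\<infinity>m\<in>{1..}. h m))" by (simp add: T)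
  have "Eis2 k s Z = ?d * ((\<Sum>\<^sub>\<infinity>c\<in>split_cosets. ?F c) + (\<Sum>\<^sub>\<infinity>c\<in>graph_cosets. ?F c))"
    unfolding Eis2_eq[OF Z] un(1) by (subst infsum_Un_disjoint[OF sum_split sum_graph un(2)]) simp
  also have "\<dots> = A_fun k s Z + ?d * (\<Sum>\<^sub>\<infinity>m\<in>{1..}. h m)"
    unfolding A_fun_eq[OF assms(1) Z] graph by (rule distrib_left)
  finally show ?thesis using sums by (simp add: sums_iff)
qed

end
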